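(* Let $X$ be a real random variable with density $f$, finite mean $\mu$, and let $q(x)=\delta x^2+\beta x+\gamma$ (real coefficients) be such that $\int_{-\infty}^x(\mu-t)f(t)\,dt=q(x)f(x)$ for all $x\in\mathbb{R}$. Let $(r,s)=\{x:f(x)>0\}$. Fix an integer $n\ge1$ and assume $\mathbb{E}|X|^{2n}<\infty$ (this implies $\delta<(2n-1)^{-1}$ and, thus, $\delta\notin\{1,1/2,\ldots,1/(2n-2)\}$ if $n\ge2$). Then for any function $g:(r,s)\to\mathbb{R}$, with derivatives $g^{(k)}$ up to order $n$, satisfying $\mathbb{E}[q^k(X)|g^{(k)}(X)|]<\infty$ for $k=0,1,\ldots,n$, $$\operatorname{Var} g(X)\ \ge\ \sum_{k=1}^n\frac{\mathbb{E}^2\bigl[q^k(X)g^{(k)}(X)\bigr]}{k!\,\mathbb{E}[q^k(X)]\prod_{j=k-1}^{2k-2}(1-j\delta)},$$ with equality if and only if $g$ is a polynomial of degree at most $n$ (on $(r,s)$).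
   Context: Here $q^k(x)=(q(x))^k$, $\mathbb{E}^2[Y]=(\mathbb{E}[Y])^2$, and $q$ has degree at most 2 ($\delta,\beta$ may be zero). The displayed identity defining $q$ implies that (after possibly redefining $f$ at finite endpoints) $\{f>0\}$ is an open interval $(r,s)$, $-\infty\le r<s\le\infty$, and that $q>0$ on $(r,s)$. "Derivatives up to order $n$" means that $g$ is $n-1$ times continuously differentiable on $(r,s)$, $g^{(n-1)}$ is locally absolutely continuous on $(r,s)$, and $g^{(n)}$ is its almost everywhere derivative. $\operatorname{Var} g(X)\in[0,\infty]$ is $+\infty$ when $\mathbb{E}[g^2(X)]=\infty$. *)

theory Defs
  imports "HOL-Probability.Probability"
begin

text \<open>
  The variance of a real random variable with finite mean as an extended real; it is
  \<open>\<infinity>\<close> when the second moment is infinite (the library \<open>variance\<close>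
  would then be the default value \<open>0\<close> of the Bochner integral).
\<close>

definition ext_variance :: "'a measure \<Rightarrow> ('a \<Rightarrow> real) \<Rightarrow> ereal" where
  "ext_variance M Y =
     (if integrable M (\<lambda>\<omega>. (Y \<omega>)\<^sup>2) then ereal (prob_space.variance M Y) else \<infinity>)"

text \<open>
  The usual epsilon-delta notion for functions on a compact interval. A finite set of pairs
  \<open>(u, v)\<close> encodes a finite family of non-overlapping intervals \<open>[u, v]\<close>;
  degenerate pairs contribute nothing to either sum.
\<close>

definition abs_continuous_on_interval :: "(real \<Rightarrow> real) \<Rightarrow> real \<Rightarrow> real \<Rightarrow> bool" where
  "abs_continuous_on_interval h a b \<longleftrightarrow>
     (\<forall>\<epsilon>>0. \<exists>\<eta>>0. \<forall>P :: (real \<times> real) set.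
        finite P \<and>
        (\<forall>(u, v)\<in>P. a \<le> u \<and> u \<le> v \<and> v \<le> b) \<and>
        pairwise (\<lambda>(u, v) (u', v'). {u<..<v} \<inter> {u'<..<v'} = {}) P \<and>
        (\<Sum>(u, v)\<in>P. v - u) < \<eta>
        \<longrightarrow> (\<Sum>(u, v)\<in>P. \<bar>h v - h u\<bar>) < \<epsilon>)"

definition locally_abs_continuous_on :: "real set \<Rightarrow> (real \<Rightarrow> real) \<Rightarrow> bool" where
  "locally_abs_continuous_on I h \<longleftrightarrow>
     (\<forall>a b. a \<le> b \<and> {a..b} \<subseteq> I \<longrightarrow> abs_continuous_on_interval h a b)"

text \<open>
  \<open>D\<close> is a family of derivatives \<open>g\<^sup>(\<^sup>k\<^sup>)\<close>, \<open>k \<le> n\<close>, of \<open>g\<close> on the open interval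
  \<open>I\<close>, for \<open>n \<ge> 1\<close>: \<open>g\<close> is \<open>n - 1\<close> times continuously differentiable, \<open>D (n - 1)\<close> is locally
  absolutely continuous and \<open>D n\<close> is any version of its almost everywhere derivative. Values
  outside \<open>I\<close> are unconstrained, except that \<open>D 0\<close> is \<open>g\<close> itself.
\<close>

definition derivatives_up_to ::
    "nat \<Rightarrow> real set \<Rightarrow> (real \<Rightarrow> real) \<Rightarrow> (nat \<Rightarrow> real \<Rightarrow> real) \<Rightarrow> bool" where
  "derivatives_up_to n I g D \<longleftrightarrow>
     D 0 = g \<and>
     (\<forall>k<n - 1. \<forall>x\<in>I. (D k has_real_derivative D (Suc k) x) (at x)) \<and>
     (\<forall>k<n. continuous_on I (D k)) \<and>
     locally_abs_continuous_on I (D (n - 1)) \<and>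
     (AE x in lborel. x \<in> I \<longrightarrow> (D (n - 1) has_real_derivative D n x) (at x))"

end

theory Submission
  imports Defs
begin

text \<open>
  Put \<open>G = q f\<close>, so that \<open>G' = (\<mu> - x) f\<close>. The polynomials \<open>\<phi>\<^sub>k\<close> given by the Rodrigues formula
  \<open>\<phi>\<^sub>k f = (-1)^k (q^k f)\<^sup>(\<^sup>k\<^sup>)\<close> satisfy \<open>E (\<phi>\<^sub>k g) = E (q^k g\<^sup>(\<^sup>k\<^sup>))\<close>. Taking \<open>g\<close> to be a polynomial of
  degree at most \<open>k\<close> shows that they are orthogonal and that \<open>E (\<phi>\<^sub>k\<^sup>2) = k! lc\<^sub>k E (q^k)\<close>, where
  \<open>lc\<^sub>k = (\<Prod>j=k-1..2k-2. 1 - j \<delta>)\<close> is the coefficient of \<open>x^k\<close> in \<open>\<phi>\<^sub>k\<close>. The inequality is therefore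
  Bessel's inequality for \<open>g\<close> and \<open>\<phi>\<^sub>1, \<dots>, \<phi>\<^sub>n\<close>, and equality means that \<open>g\<close> lies in the span
  of \<open>\<phi>\<^sub>0, \<dots>, \<phi>\<^sub>n\<close>, that is, among the polynomials of degree at most \<open>n\<close>.
\<close>

subsection \<open>Absolutely continuous functions\<close>

text \<open>The obstacle is the identity \<open>E (\<phi>\<^sub>k g) = E (q^k g^(k))\<close>: the
  hypotheses bound only the moments of \<open>q^k |g^(k)|\<close>, say nothing about the behaviour
  of \<open>g\<close> at \<open>r\<close> and \<open>s\<close>, and do not provide integrability of
  the products met on the way from \<open>g^(k)\<close> down to \<open>g\<close>. Each integration
  by parts is therefore one use of Fubini's theorem in which integrability of the lower-order
  product is a conclusion. This works because the factor multiplying the lower derivative is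
  \<open>f\<close> times a polynomial, hence of constant sign near both ends of
  \<open>(r, s)\<close>. Bessel's inequality also requires positive norms. Their sign is that of
  \<open>lc\<^sub>k\<close>, and it is settled by \<open>(2 n - 1) \<delta> < 1\<close>, obtained by
  applying the Pearson identity to the weight \<open>q^(n-1) f\<close>. The derivative of order
  \<open>n\<close> exists only almost everywhere and is given as an arbitrary version. Hence the
  fundamental theorem of calculus for absolutely continuous functions, and the replacement of the
  version by a Borel one.\<close>

lemma abs_continuous_tagged_sum:
  fixes h :: "real \<Rightarrow> real"
  assumes "abs_continuous_on_interval h a b" "0 < e"
  obtains \<eta> where "0 < \<eta>"
    "\<And>p T. p tagged_partial_division_of {a..b} \<Longrightarrow> T \<in> sets lborel \<Longrightarrow>
       emeasure lborel T < ennreal \<eta> \<Longrightarrow> (\<And>x K. (x, K) \<in> p \<Longrightarrow> K \<subseteq> T) \<Longrightarrow>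
       (\<Sum>(x, K)\<in>p. \<bar>h (Sup K) - h (Inf K)\<bar>) < e"
proof -
  obtain \<eta> where \<eta>: "\<eta> > 0" "\<And>P :: (real \<times> real) set. finite P \<Longrightarrow>
        (\<forall>(u, v)\<in>P. a \<le> u \<and> u \<le> v \<and> v \<le> b) \<Longrightarrow>
        pairwise (\<lambda>(u, v) (u', v'). {u<..<v} \<inter> {u'<..<v'} = {}) P \<Longrightarrow>
        (\<Sum>(u, v)\<in>P. v - u) < \<eta> \<Longrightarrow> (\<Sum>(u, v)\<in>P. \<bar>h v - h u\<bar>) < e"
    using assms unfolding abs_continuous_on_interval_def by meson
  show thesis
  proof (rule that[OF \<eta>(1)])
    fix p and T :: "real set"
    assume p: "p tagged_partial_division_of {a..b}" and T: "T \<in> sets lborel"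
      "emeasure lborel T < ennreal \<eta>" and sub: "\<And>x K. (x, K) \<in> p \<Longrightarrow> K \<subseteq> T"
    note pD = tagged_partial_division_ofD[OF p]
    \<comment> \<open>Absolute continuity is stated for sets of endpoint pairs, so the tags have to
      be dropped. The interiors of the pieces are disjoint subsets of \<open>T\<close>, which puts
      their total length below \<open>\<eta>\<close>.\<close>
    define c where "c = (\<lambda>(x :: real, K :: real set). (Inf K, Sup K))"
    have K: "K = {Inf K..Sup K} \<and> Inf K \<le> Sup K \<and> a \<le> Inf K \<and> Sup K \<le> b" if xK: "(x, K) \<in> p" for x K
    proof -
      obtain u v where "K = {u..v}" using pD(4)[OF xK] by auto
      moreover have "x \<in> K" "K \<subseteq> {a..b}" using pD(2,3)[OF xK] by auto
      ultimately show ?thesis by auto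
    qed
    have int_K: "interior K = {Inf K<..<Sup K}" if "(x, K) \<in> p" for x K
      using K[OF that] by (metis interior_atLeastAtMost_real)
    have disj: "{Inf K<..<Sup K} \<inter> {Inf K'<..<Sup K'} = {}"
      if "(x, K) \<in> p" "(x', K') \<in> p" "(x, K) \<noteq> (x', K')" for x K x' K'
      using pD(5)[OF that] int_K that by metis
    have degenerate: "Inf K = Sup K"
      if "(x, K) \<in> p" "(x', K') \<in> p" "(x, K) \<noteq> (x', K')" "c (x, K) = c (x', K')" for x K x' K'
      using disj[OF that(1-3)] K[OF that(1)] that(4) by (auto simp: c_def)
    \<comment> \<open>\<open>c\<close> need not be injective, but two pieces with the same endpoints
      and disjoint interiors are degenerate, and degenerate pieces contribute 0 to either
      sum.\<close>
    have reindex: "(\<Sum>(u, v)\<in>c ` p. F u v) = (\<Sum>(x, K)\<in>p. F (Inf K) (Sup K))"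
      if "\<And>u. F u u = 0" for F :: "real \<Rightarrow> real \<Rightarrow> real"
    proof (subst sum.reindex_nontrivial)
      fix y z assume "y \<in> p" "z \<in> p" "y \<noteq> z" "c y = c z"
      then show "(case c y of (u, v) \<Rightarrow> F u v) = 0"
        using degenerate[of "fst y" "snd y" "fst z" "snd z"] that
        by (auto simp: c_def split: prod.splits)
    qed (auto simp: c_def pD(1) intro!: sum.cong)
    have "ennreal (\<Sum>(x, K)\<in>p. Sup K - Inf K) = (\<Sum>(x, K)\<in>p. emeasure lborel {Inf K<..<Sup K})"
    proof -
      have "(\<Sum>(x, K)\<in>p. emeasure lborel {Inf K<..<Sup K}) = (\<Sum>(x, K)\<in>p. ennreal (Sup K - Inf K))"
        using K by (intro sum.cong) (auto simp: emeasure_lborel_Ioo)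
      also have "\<dots> = ennreal (\<Sum>(x, K)\<in>p. Sup K - Inf K)"
        unfolding split_def by (rule sum_ennreal) (use K in force)
      finally show ?thesis by simp
    qed
    also have "\<dots> = emeasure lborel (\<Union>i\<in>p. {Inf (snd i)<..<Sup (snd i)})"
      unfolding split_def
    proof (rule sum_emeasure)
      show "disjoint_family_on (\<lambda>i. {Inf (snd i)<..<Sup (snd i)}) p"
        using disj unfolding disjoint_family_on_def by (metis prod.collapse)
    qed (auto simp: pD(1))
    also have "\<dots> \<le> emeasure lborel T"
    proof (rule emeasure_mono[OF _ T(1)])
      show "(\<Union>i\<in>p. {Inf (snd i)<..<Sup (snd i)}) \<subseteq> T"
      proof (rule UN_least)
        fix i assume "i \<in> p"
        then have "(fst i, snd i) \<in> p" by simp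
        from int_K[OF this] sub[OF this] show "{Inf (snd i)<..<Sup (snd i)} \<subseteq> T"
          using interior_subset[of "snd i"] by auto
      qed
    qed
    also note T(2)
    finally have "(\<Sum>(x, K)\<in>p. Sup K - Inf K) < \<eta>"
      by (metis ennreal_leI not_le)
    then have "(\<Sum>(u, v)\<in>c ` p. v - u) < \<eta>"
      by (subst reindex) auto
    then have "(\<Sum>(u, v)\<in>c ` p. \<bar>h v - h u\<bar>) < e"
    proof (intro \<eta>(2))
      show "pairwise (\<lambda>(u, v) (u', v'). {u<..<v} \<inter> {u'<..<v'} = {}) (c ` p)"
        unfolding pairwise_def c_def using disj by (clarsimp, metis)
    qed (use pD(1) K in \<open>auto simp: c_def\<close>)
    then show "(\<Sum>(x, K)\<in>p. \<bar>h (Sup K) - h (Inf K)\<bar>) < e"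
      by (subst (asm) reindex) auto
  qed
qed

text \<open>Gauge argument with the derivative set to 0 on the exceptional null set
  \<open>N\<close>. Pieces tagged in \<open>N\<close> stay inside an open \<open>T\<close> of
  measure below \<open>\<eta>\<close>, so absolute continuity makes the sum of their increments
  small; pieces tagged elsewhere are controlled by differentiability at the tag.\<close>

theorem fundamental_theorem_of_calculus_abs_continuous:
  fixes h h' :: "real \<Rightarrow> real"
  assumes ac: "abs_continuous_on_interval h a b" and "a \<le> b"
    and deriv: "AE x in lborel. x \<in> {a..b} \<longrightarrow> (h has_real_derivative h' x) (at x)"
  shows "(h' has_integral (h b - h a)) {a..b}"
proof -
  obtain N where N: "N \<in> null_sets lborel"
    "{x. \<not> (x \<in> {a..b} \<longrightarrow> (h has_real_derivative h' x) (at x))} \<subseteq> N"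
    using deriv unfolding eventually_ae_filter by auto
  have d: "(h has_real_derivative h' x) (at x)" if "x \<in> {a..b}" "x \<notin> N" for x
    using N(2) that by auto
  define h0 where "h0 x = (if x \<in> N then 0 else h' x)" for x
  have "(h0 has_integral (h b - h a)) {a..b}"
    unfolding has_integral_real
  proof safe
    fix e :: real assume "e > 0"
    \<comment> \<open>The summand 1 keeps the denominator positive when
      \<open>a = b\<close>.\<close>
    define e' where "e' = e / 2 / (b - a + 1)"
    have e': "e' > 0" "e' * (b - a) \<le> e / 2"
      using \<open>a \<le> b\<close> \<open>e > 0\<close> by (auto simp: e'_def field_simps)
    obtain \<eta> where \<eta>: "0 < \<eta>"
      "\<And>p T. p tagged_partial_division_of {a..b} \<Longrightarrow> T \<in> sets lborel \<Longrightarrow>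
       emeasure lborel T < ennreal \<eta> \<Longrightarrow> (\<And>x K. (x, K) \<in> p \<Longrightarrow> K \<subseteq> T) \<Longrightarrow>
       (\<Sum>(x, K)\<in>p. \<bar>h (Sup K) - h (Inf K)\<bar>) < e / 2"
      using abs_continuous_tagged_sum[OF ac half_gt_zero[OF \<open>e > 0\<close>]] by blast
    obtain T where T: "open T" "N \<subseteq> T" "emeasure lborel (T - N) \<le> \<eta> / 2"
      using outer_regular_lborel_le[of N "\<eta> / 2"] N(1) \<eta>(1)
      by (metis half_gt_zero null_setsD2 sets_lborel)
    have "emeasure lborel T = emeasure lborel (T - N)"
      using N(1) T(1) by (simp add: emeasure_Diff_null_set)
    also have "\<dots> < ennreal \<eta>"
      using T(3) \<eta>(1) by (metis ennreal_lessI field_sum_of_halves less_add_same_cancel1 half_gt_zero order_le_less_trans)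
    finally have T': "emeasure lborel T < ennreal \<eta>" .
    have "\<exists>r. 0 < r \<and> (x \<in> N \<longrightarrow> ball x r \<subseteq> T) \<and> (x \<in> {a..b} \<longrightarrow> x \<notin> N \<longrightarrow>
        (\<forall>y. \<bar>y - x\<bar> < r \<longrightarrow> \<bar>h y - h x - (y - x) * h' x\<bar> \<le> e' * \<bar>y - x\<bar>))" for x
    proof -
      consider "x \<in> N" | "x \<in> {a..b}" "x \<notin> N" | "x \<notin> {a..b}" "x \<notin> N" by blast
      then show ?thesis
      proof cases
        case 1
        then obtain r where "0 < r" "ball x r \<subseteq> T" using T(1,2) open_contains_ball by blast
        then show ?thesis using 1 by blast
      next
        case 2
        then have "(h has_derivative (*) (h' x)) (at x)"
          using d unfolding has_field_derivative_def by blast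
        then obtain r where "0 < r" "\<And>y. \<bar>y - x\<bar> < r \<Longrightarrow> \<bar>h y - h x - h' x * (y - x)\<bar> \<le> e' * \<bar>y - x\<bar>"
          using e'(1) unfolding has_derivative_within_alt by (auto simp: real_norm_def)
        then show ?thesis using 2 by (auto simp: mult.commute)
      next
        case 3
        then show ?thesis using zero_less_one by blast
      qed
    qed
    then obtain \<rho> where \<rho>: "\<And>x. 0 < \<rho> x" "\<And>x. x \<in> N \<Longrightarrow> ball x (\<rho> x) \<subseteq> T"
      "\<And>x y. x \<in> {a..b} \<Longrightarrow> x \<notin> N \<Longrightarrow> \<bar>y - x\<bar> < \<rho> x \<Longrightarrow>
        \<bar>h y - h x - (y - x) * h' x\<bar> \<le> e' * \<bar>y - x\<bar>"
      by metis
    show "\<exists>\<gamma>. gauge \<gamma> \<and> (\<forall>\<D>. \<D> tagged_division_of {a..b} \<and> \<gamma> fine \<D> \<longrightarrow>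
            norm ((\<Sum>(x, k)\<in>\<D>. measure lborel k *\<^sub>R h0 x) - (h b - h a)) < e)"
    proof (intro exI conjI allI impI; (elim conjE)?)
      show "gauge (\<lambda>x. ball x (\<rho> x))"
        using \<rho>(1) gauge_ball_dependent by blast
      fix p assume p: "p tagged_division_of {a..b}" and fine: "(\<lambda>x. ball x (\<rho> x)) fine p"
      note pD = tagged_division_ofD[OF p]
      define pN where "pN = {i\<in>p. fst i \<in> N}"
      let ?e = "\<lambda>(x, K). measure lborel K *\<^sub>R h0 x - (h (Sup K) - h (Inf K))"
      have pN: "pN \<subseteq> p" "finite p" using pD(1) by (auto simp: pN_def)
      have "(\<Sum>(x, K)\<in>pN. \<bar>h (Sup K) - h (Inf K)\<bar>) < e / 2"
      proof (rule \<eta>(2)[OF _ _ T'])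
        show "pN tagged_partial_division_of {a..b}"
          using p pN(1) tagged_partial_division_subset by (metis tagged_division_of_def)
        show "T \<in> sets lborel" using T(1) by simp
        show "K \<subseteq> T" if "(x, K) \<in> pN" for x K
          using fineD[OF fine, of x K] \<rho>(2)[of x] that by (auto simp: pN_def)
      qed
      moreover have "\<bar>sum ?e pN\<bar> \<le> (\<Sum>(x, K)\<in>pN. \<bar>h (Sup K) - h (Inf K)\<bar>)"
        by (rule order_trans[OF sum_abs], rule sum_mono) (auto simp: pN_def h0_def)
      moreover have "\<bar>sum ?e (p - pN)\<bar> \<le> e / 2"
      proof -
        have "\<bar>?e (x, K)\<bar> \<le> e' * (Sup K - Inf K)" if i: "(x, K) \<in> p - pN" for x K
        proof -
          obtain u v where k: "K = {u..v}" and xK: "x \<in> K" and kab: "K \<subseteq> {a..b}"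
            using pD(2-4)[of x K] i by auto
          have uv: "u \<le> x" "x \<le> v" "u \<le> v" using xK k by auto
          have "{u..v} \<subseteq> ball x (\<rho> x)" using fineD[OF fine, of x K] i k by auto
          then have "u \<in> ball x (\<rho> x)" "v \<in> ball x (\<rho> x)" using uv by (meson atLeastAtMost_iff order_refl subsetD)+
          then have "\<bar>u - x\<bar> < \<rho> x" "\<bar>v - x\<bar> < \<rho> x" by (auto simp: dist_real_def)
          moreover have x: "x \<in> {a..b}" "x \<notin> N" using xK kab i by (auto simp: pN_def)
          ultimately have "\<bar>h u - h x - (u - x) * h' x\<bar> \<le> e' * \<bar>u - x\<bar>"
            "\<bar>h v - h x - (v - x) * h' x\<bar> \<le> e' * \<bar>v - x\<bar>" using \<rho>(3) by blast+
          \<comment> \<open>The tag lies between the endpoints, so the two errors, proportional to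
            \<open>x - u\<close> and \<open>v - x\<close>, add up to one proportional to
            \<open>v - u\<close>.\<close>
          then have "\<bar>(v - u) * h' x - (h v - h u)\<bar> \<le> e' * (v - u)"
            using uv by (simp add: algebra_simps abs_le_iff)
          then show ?thesis using uv x by (simp add: k h0_def)
        qed
        then have "\<bar>sum ?e (p - pN)\<bar> \<le> (\<Sum>(x, K)\<in>p - pN. e' * (Sup K - Inf K))"
          by (intro order_trans[OF sum_abs] sum_mono) auto
        also have "\<dots> \<le> (\<Sum>(x, K)\<in>p. e' * (Sup K - Inf K))"
        proof (rule sum_mono2)
          fix i assume "i \<in> p - (p - pN)"
          then obtain x K where i: "i = (x, K)" "(x, K) \<in> p" by (cases i) auto
          obtain u v where "K = {u..v}" "x \<in> K" using pD(2,4)[OF i(2)] by auto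
          then show "0 \<le> (case i of (x, K) \<Rightarrow> e' * (Sup K - Inf K))"
            using e'(1) i by auto
        qed (use pN in auto)
        also have "\<dots> = e' * (b - a)"
          using additive_tagged_division_1[OF \<open>a \<le> b\<close> p, of "\<lambda>x. x"]
          by (simp add: sum_distrib_left[symmetric] split_def)
        finally show ?thesis using e'(2) by simp
      qed
      moreover have "(\<Sum>(x, k)\<in>p. measure lborel k *\<^sub>R h0 x) - (h b - h a) = sum ?e pN + sum ?e (p - pN)"
      proof -
        have "sum ?e pN + sum ?e (p - pN) = sum ?e p"
          using sum.subset_diff[OF pN, of ?e] by simp
        also have "\<dots> = (\<Sum>(x, k)\<in>p. measure lborel k *\<^sub>R h0 x) - (h b - h a)"
          using additive_tagged_division_1[OF \<open>a \<le> b\<close> p, of h] by (simp add: sum_subtractf split_def)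
        finally show ?thesis by simp
      qed
      ultimately show "norm ((\<Sum>(x, k)\<in>p. measure lborel k *\<^sub>R h0 x) - (h b - h a)) < e"
        by simp
    qed
  qed
  moreover have "negligible N"
    using N(1) null_sets_completionI by (auto simp: negligible_iff_null_sets)
  ultimately show ?thesis
    by (rule has_integral_spike[rotated 2]) (auto simp: h0_def)
qed

lemma locally_abs_continuous_onD:
  "locally_abs_continuous_on S h \<Longrightarrow> a \<le> b \<Longrightarrow> {a..b} \<subseteq> S \<Longrightarrow> abs_continuous_on_interval h a b"
  unfolding locally_abs_continuous_on_def by blast

text \<open>An arbitrary version of the derivative may fail to be Borel. The limit of difference
  quotients along \<open>1 / (m + 1)\<close> is Borel once \<open>h\<close> is extended by 0, and
  since \<open>S\<close> is open the extension changes no derivative inside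
  \<open>S\<close>.\<close>

lemma borel_AE_derivative:
  fixes h h' :: "real \<Rightarrow> real"
  assumes "open S" "continuous_on S h"
    and deriv: "AE x in lborel. x \<in> S \<longrightarrow> (h has_real_derivative h' x) (at x)"
  obtains H where "H \<in> borel_measurable borel" "AE x in lborel. x \<in> S \<longrightarrow> H x = h' x"
proof -
  define h0 where "h0 x = indicator S x *\<^sub>R h x" for x
  have [measurable]: "h0 \<in> borel_measurable borel"
    unfolding h0_def using assms(1,2) by (intro borel_measurable_continuous_on_indicator) auto
  define H where "H x = lim (\<lambda>m. (h0 (x + inverse (real (Suc m))) - h0 x) / inverse (real (Suc m)))" for x
  have "H \<in> borel_measurable borel" unfolding H_def by measurable
  moreover have "AE x in lborel. x \<in> S \<longrightarrow> H x = h' x"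
    using deriv
  proof eventually_elim
    case (elim x)
    show ?case
    proof
      assume x: "x \<in> S"
      have "(h0 has_real_derivative h' x) (at x)"
        by (rule has_field_derivative_transform_within_open[OF _ assms(1) x]) (use elim x in \<open>auto simp: h0_def\<close>)
      then have "((\<lambda>e. (h0 (x + e) - h0 x) / e) \<longlongrightarrow> h' x) (at 0)" by (simp add: DERIV_def)
      moreover have "filterlim (\<lambda>m. inverse (real (Suc m))) (at 0) sequentially"
        unfolding filterlim_at using LIMSEQ_inverse_real_of_nat by auto
      ultimately have "(\<lambda>m. (h0 (x + inverse (real (Suc m))) - h0 x) / inverse (real (Suc m))) \<longlonglongrightarrow> h' x"
        by (rule filterlim_compose)
      then show "H x = h' x" unfolding H_def by (rule limI)
    qed
  qed
  ultimately show thesis by (rule that)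
qed

subsection \<open>Integrals, polynomials and orthogonal expansions\<close>

text \<open>A nonempty open set is not Lebesgue null; the strict inequalities for \<open>q\<close>,
  for the means and for the norms all rest on this.\<close>

lemma integral_pos_open:
  fixes h :: "real \<Rightarrow> real"
  assumes "integrable lborel h" "\<And>x. 0 \<le> h x" "open S" "S \<noteq> {}" "\<And>x. x \<in> S \<Longrightarrow> 0 < h x"
  shows "0 < (\<integral>x. h x \<partial>lborel)"
proof (rule ccontr)
  assume "\<not> ?thesis"
  then have "(\<integral>x. h x \<partial>lborel) = 0"
    using assms(2) by (simp add: integral_nonneg_AE order_antisym)
  then have "AE x in lborel. h x = 0"
    using assms(1,2) by (subst (asm) integral_nonneg_eq_0_iff_AE) auto
  then have "AE x in lborel. x \<notin> S"
    by eventually_elim (use assms(5) in force)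
  then have "S \<in> null_sets lborel"
    using assms(3) by (subst AE_iff_null_sets) auto
  then have "negligible S"
    using null_sets_completionI negligible_iff_null_sets by blast
  then show False using assms(3,4) open_not_negligible by blast
qed

lemma set_integrable_of_integrable:
  "integrable lborel h \<Longrightarrow> A \<in> sets borel \<Longrightarrow> set_integrable lborel A (h :: real \<Rightarrow> real)"
  unfolding set_integrable_def by (rule integrable_mult_indicator) auto

lemma atMost_Un_greaterThan: "{..x} \<union> {x<..} = (UNIV :: 'b::linorder set)"
  by auto

lemma set_integral_atMost_eq:
  fixes h :: "real \<Rightarrow> real"
  assumes h: "integrable lborel h" and "a \<le> b"
  shows "(LINT t:{..b}|lborel. h t) = (LINT t:{..a}|lborel. h t) + integral {a..b} h"
proof -
  note int = set_integrable_of_integrable[OF h]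
  have "{..b} = {..a} \<union> {a<..b}" using \<open>a \<le> b\<close> by auto
  then have "(LINT t:{..b}|lborel. h t) = (LINT t:{..a}|lborel. h t) + (LINT t:{a<..b}|lborel. h t)"
    by (simp only:) (subst set_integral_Un, auto intro: int)
  moreover have "(LINT t:{a<..b}|lborel. h t) = integral {a<..b} h"
    by (rule set_borel_integral_eq_integral(2)[OF int]) simp
  moreover have "integral {a<..b} h = integral {a..b} h"
    by (rule integral_spike_set) (auto intro: negligible_subset[of "{a}"])
  ultimately show ?thesis by simp
qed

lemma set_integral_atMost_at_top:
  fixes h :: "real \<Rightarrow> real"
  assumes "integrable lborel h"
  shows "((\<lambda>x. LINT t:{..x}|lborel. h t) \<longlongrightarrow> (\<integral>t. h t \<partial>lborel)) at_top"
  unfolding set_lebesgue_integral_def using assms by (intro tendsto_integral_at_top) auto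

lemma set_integral_atMost_at_bot:
  fixes h :: "real \<Rightarrow> real"
  assumes h: "integrable lborel h"
  shows "((\<lambda>x. LINT t:{..x}|lborel. h t) \<longlongrightarrow> 0) at_bot"
  unfolding filterlim_at_bot_mirror
proof (rule tendsto_at_topI_sequentially)
  fix X :: "nat \<Rightarrow> real" assume X: "filterlim X at_top sequentially"
  have "(\<lambda>n. LINT t:{..- X n}|lborel. h t) \<longlonglongrightarrow> (\<integral>t. 0 \<partial>(lborel :: real measure))"
    unfolding set_lebesgue_integral_def
  proof (rule integral_dominated_convergence[where w = "\<lambda>x. norm (h x)"])
    show "AE x in lborel. (\<lambda>n. indicator {..- X n} x *\<^sub>R h x) \<longlonglongrightarrow> 0"
    proof
      fix x :: real
      have "eventually (\<lambda>n. - x + 1 \<le> X n) sequentially"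
        using X unfolding filterlim_at_top by blast
      then show "(\<lambda>n. indicator {..- X n} x *\<^sub>R h x) \<longlonglongrightarrow> 0"
        by (intro tendsto_eventually) (auto elim!: eventually_mono split: split_indicator)
    qed
  qed (use h in \<open>auto split: split_indicator\<close>)
  then show "(\<lambda>n. LINT t:{..- X n}|lborel. h t) \<longlonglongrightarrow> 0" by simp
qed

text \<open>A nonzero polynomial has finitely many roots, and by the intermediate value theorem it
  keeps its sign to the left and to the right of all of them. Adding \<open>y\<close> to the roots
  makes the set nonempty and places \<open>y\<close> between its minimum \<open>a\<close> and its
  maximum \<open>b\<close>.\<close>

lemma poly_eventually_const_sign:
  fixes P :: "real poly"
  assumes "y \<in> einterval r s"
  obtains a b where "a \<in> einterval r s" "b \<in> einterval r s" "a \<le> y" "y \<le> b"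
    "(\<forall>x\<in>einterval r s. b < x \<longrightarrow> 0 \<le> poly P x) \<or> (\<forall>x\<in>einterval r s. b < x \<longrightarrow> poly P x \<le> 0)"
    "(\<forall>x\<in>einterval r s. x < a \<longrightarrow> 0 \<le> poly P x) \<or> (\<forall>x\<in>einterval r s. x < a \<longrightarrow> poly P x \<le> 0)"
proof (cases "P = 0")
  case True
  then show ?thesis using assms by (intro that[of y y]) auto
next
  case False
  let ?I = "einterval r s"
  define Z where "Z = insert y {x\<in>?I. poly P x = 0}"
  have Z: "finite Z" "Z \<noteq> {}" "Z \<subseteq> ?I" "y \<in> Z"
    using poly_roots_finite[OF False] assms by (auto simp: Z_def)
  have cont: "continuous_on A (poly P)" for A
    by (rule continuous_on_poly[OF continuous_on_id])
  have root: "\<exists>x\<in>Z. u \<le> x \<and> x \<le> v" if "u \<in> ?I" "v \<in> ?I" "u \<le> v" "poly P u * poly P v \<le> 0" for u v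
  proof -
    have "\<exists>x. u \<le> x \<and> x \<le> v \<and> poly P x = 0"
    proof (cases "poly P u \<le> 0")
      case True
      show ?thesis
      proof (cases "poly P u = 0")
        case False
        then have "0 \<le> poly P v" using True that(4) by (simp add: mult_le_0_iff)
        then show ?thesis using IVT'[of "poly P" u 0 v, OF _ _ _ cont] True that(3) by auto
      qed (use that in auto)
    next
      case False
      then have "poly P v \<le> 0" using that(4) by (simp add: mult_le_0_iff)
      then show ?thesis using IVT2'[of "poly P" v 0 u, OF _ _ _ cont] False that(3) by auto
    qed
    then obtain x where x: "u \<le> x" "x \<le> v" "poly P x = 0" by auto
    then have "x \<in> ?I"
      using that(1,2) unfolding einterval_iff by (metis ereal_less_eq(3) le_less_trans less_le_trans)
    then show ?thesis using x by (auto simp: Z_def)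
  qed
  have *: "(\<forall>x\<in>S. 0 \<le> poly P x) \<or> (\<forall>x\<in>S. poly P x \<le> 0)"
    if S: "S \<subseteq> ?I" "\<And>u v x. u \<in> S \<Longrightarrow> v \<in> S \<Longrightarrow> u \<le> x \<Longrightarrow> x \<le> v \<Longrightarrow> x \<notin> Z" for S
  proof (rule ccontr)
    assume "\<not> ?thesis"
    then obtain u v where uv: "u \<in> S" "v \<in> S" "poly P u < 0" "0 < poly P v"
      by (meson not_le)
    then have "poly P u * poly P v \<le> 0" "poly P v * poly P u \<le> 0"
      by (simp_all add: mult_le_0_iff)
    then have "\<exists>x\<in>Z. min u v \<le> x \<and> x \<le> max u v"
      using root[of u v] root[of v u] uv S(1) by (cases "u \<le> v") (auto simp: min_def max_def)
    then show False using S(2)[of u v] S(2)[of v u] uv by (cases "u \<le> v") (auto simp: min_def max_def)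
  qed
  show ?thesis
  proof (rule that[of "Min Z" "Max Z"])
    show "Min Z \<in> ?I" "Max Z \<in> ?I" using Z Min_in Max_in by blast+
    show "Min Z \<le> y" "y \<le> Max Z" using Z by auto
    have "x \<notin> Z" if "Max Z < u" "u \<le> x" for u x
      using Z(1) that by (metis Max_ge less_le_trans not_le)
    then show "(\<forall>x\<in>?I. Max Z < x \<longrightarrow> 0 \<le> poly P x) \<or> (\<forall>x\<in>?I. Max Z < x \<longrightarrow> poly P x \<le> 0)"
      using *[of "{x\<in>?I. Max Z < x}"] by blast
    have "x \<notin> Z" if "v < Min Z" "x \<le> v" for v x
      using Z(1) that by (metis Min_le le_less_trans not_le)
    then show "(\<forall>x\<in>?I. x < Min Z \<longrightarrow> 0 \<le> poly P x) \<or> (\<forall>x\<in>?I. x < Min Z \<longrightarrow> poly P x \<le> 0)"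
      using *[of "{x\<in>?I. x < Min Z}"] by blast
  qed
qed

text \<open>Stated with bounds on the degrees because these need not be attained:
  \<open>\<delta>\<close>, and with it the leading coefficient of \<open>q\<close>, may
  vanish.\<close>

lemma coeff_mult_bound:
  fixes p q :: "real poly"
  assumes "degree p \<le> i" "degree q \<le> j"
  shows "coeff (p * q) (i + j) = coeff p i * coeff q j"
proof -
  have "coeff (p * q) (i + j) = (\<Sum>l\<le>i + j. coeff p l * coeff q (i + j - l))"
    by (simp add: coeff_mult)
  also have "\<dots> = (\<Sum>l\<in>{i}. coeff p l * coeff q (i + j - l))"
  proof (rule sum.mono_neutral_right)
    show "\<forall>l\<in>{..i + j} - {i}. coeff p l * coeff q (i + j - l) = 0"
    proof
      fix l assume "l \<in> {..i + j} - {i}"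
      then consider "i < l" | "j < i + j - l" by force
      then show "coeff p l * coeff q (i + j - l) = 0"
        using assms by cases (simp_all add: coeff_eq_0)
    qed
  qed auto
  finally show ?thesis by simp
qed

text \<open>A single application of Fubini's theorem to the kernel
  \<open>K x t = 1 [y < x < t] - 1 [t \<le> x \<le> y]\<close>, for which \<open>h t - h y = \<integral> K x t * h' x dx\<close> and
  \<open>\<integral> K x t * u t dt = - U x\<close>. Near the ends of the interval the sign of \<open>u\<close> is constant, so there
  the integral of \<open>\<bar>K x t * u t\<bar>\<close> is \<open>\<bar>U x\<bar>\<close>; no boundary behaviour of \<open>h\<close> is needed.\<close>

lemma integral_by_parts_const_sign:
  fixes u h h' U :: "real \<Rightarrow> real"
  assumes y: "a \<in> einterval r s" "b \<in> einterval r s" "a \<le> y" "y \<le> b"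
    and u: "integrable lborel u" "(\<integral>t. u t \<partial>lborel) = 0" "\<And>t. t \<notin> einterval r s \<Longrightarrow> u t = 0"
    and U: "\<And>x. U x = (LINT t:{..x}|lborel. u t)"
    and right: "(\<forall>x\<in>einterval r s. b < x \<longrightarrow> 0 \<le> u x) \<or> (\<forall>x\<in>einterval r s. b < x \<longrightarrow> u x \<le> 0)"
    and left: "(\<forall>x\<in>einterval r s. x < a \<longrightarrow> 0 \<le> u x) \<or> (\<forall>x\<in>einterval r s. x < a \<longrightarrow> u x \<le> 0)"
    and h'_meas [measurable]: "h' \<in> borel_measurable borel"
    and h'_loc: "\<And>c d. c \<in> einterval r s \<Longrightarrow> d \<in> einterval r s \<Longrightarrow> c \<le> d \<Longrightarrow> set_integrable lborel {c..d} h'"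
    and ftc: "\<And>c d. c \<in> einterval r s \<Longrightarrow> d \<in> einterval r s \<Longrightarrow> c \<le> d \<Longrightarrow>
               (LINT x:{c..d}|lborel. h' x) = h d - h c"
    and int: "integrable lborel (\<lambda>x. h' x * U x)"
  shows "integrable lborel (\<lambda>t. u t * h t)"
    and "(\<integral>t. u t * h t \<partial>lborel) = - (\<integral>x. h' x * U x \<partial>lborel)"
proof -
  let ?I = "einterval r s"
  have yI: "y \<in> ?I"
    using y unfolding einterval_iff by (metis ereal_less_eq(3) le_less_trans less_le_trans)
  have u_meas [measurable]: "u \<in> borel_measurable borel" using u(1) by simp
  \<comment> \<open>Strict on one side and weak on the other, so that \<open>K x\<close> is exactly
    the indicator of \<open>{x<..}\<close> or minus that of \<open>{..x}\<close>, matching the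
    definition of \<open>U\<close>. The discrepancy at single points does not affect integrals in
    \<open>x\<close>.\<close>
  define K :: "real \<Rightarrow> real \<Rightarrow> real" where
    "K x t = (if y < x \<and> x < t then 1 else 0) - (if t \<le> x \<and> x \<le> y then 1 else 0)" for x t
  define F where "F = (\<lambda>(x, t). h' x * (K x t * u t))"
  have K_upper: "K x t = indicator {x<..} t" if "y < x" for x t
    using that by (auto simp: K_def split: split_indicator)
  have K_lower: "K x t = - indicator {..x} t" if "x \<le> y" for x t
    using that by (auto simp: K_def split: split_indicator)
  note int_u = set_integrable_of_integrable[OF u(1)]
  have int_abs: "set_integrable lborel A (\<lambda>t. \<bar>u t\<bar>)" if "A \<in> sets borel" for A
    using set_integrable_of_integrable[OF integrable_abs[OF u(1)] that] .
  have upper: "(LINT t:{x<..}|lborel. u t) = - U x" for x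
  proof -
    have "0 = (LINT t:{..x} \<union> {x<..}|lborel. u t)"
      using u(2) unfolding atMost_Un_greaterThan by (simp add: set_lebesgue_integral_def)
    also have "\<dots> = U x + (LINT t:{x<..}|lborel. u t)"
      unfolding U by (intro set_integral_Un int_u) auto
    finally show ?thesis by simp
  qed
  have K_u: "(\<integral>t. K x t * u t \<partial>lborel) = - U x" for x
  proof (cases "y < x")
    case True
    then show ?thesis using upper[of x] by (simp add: K_upper set_lebesgue_integral_def)
  next
    case False
    then show ?thesis by (simp add: K_lower U set_lebesgue_integral_def)
  qed
  have int_K: "integrable lborel (\<lambda>t. K x t * u t)" for x
    using int_u[of "{x<..}"] int_u[of "{..x}"]
    by (cases "y < x") (auto simp: K_upper K_lower set_integrable_def)
  define A where "A x = (\<integral>t. \<bar>K x t * u t\<bar> \<partial>lborel)" for x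
  have A_le: "A x \<le> (\<integral>t. \<bar>u t\<bar> \<partial>lborel)" for x
    unfolding A_def using u(1) int_K[of x]
    by (intro integral_mono integrable_abs) (auto simp: K_def abs_mult)
  have set_le: "(LINT t:S|lborel. \<bar>u t\<bar>) \<le> \<bar>LINT t:S|lborel. u t\<bar>"
    if "(\<forall>t\<in>S. 0 \<le> u t) \<or> (\<forall>t\<in>S. u t \<le> 0)" for S
    using that
  proof
    assume "\<forall>t\<in>S. 0 \<le> u t"
    then have "(LINT t:S|lborel. \<bar>u t\<bar>) = (LINT t:S|lborel. u t)"
      unfolding set_lebesgue_integral_def
      by (intro Bochner_Integration.integral_cong) (auto split: split_indicator)
    then show ?thesis by simp
  next
    assume "\<forall>t\<in>S. u t \<le> 0"
    then have "(LINT t:S|lborel. \<bar>u t\<bar>) = (LINT t:S|lborel. - u t)"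
      unfolding set_lebesgue_integral_def
      by (intro Bochner_Integration.integral_cong) (auto split: split_indicator)
    also have "\<dots> = - (LINT t:S|lborel. u t)" by (simp add: set_lebesgue_integral_def)
    finally show ?thesis by simp
  qed
  have A_right: "A x \<le> \<bar>U x\<bar>" if "b < x" for x
  proof -
    have "A x = (LINT t:{x<..}|lborel. \<bar>u t\<bar>)"
      unfolding A_def set_lebesgue_integral_def using that y(4)
      by (intro Bochner_Integration.integral_cong) (auto simp: K_upper abs_mult)
    also have "\<dots> \<le> \<bar>LINT t:{x<..}|lborel. u t\<bar>"
    proof (rule set_le, use right in \<open>elim disjE\<close>)
      assume "\<forall>x\<in>?I. b < x \<longrightarrow> 0 \<le> u x"
      then have "\<forall>t\<in>{x<..}. 0 \<le> u t" using u(3) that by (metis greaterThan_iff less_trans order_refl)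
      then show "(\<forall>t\<in>{x<..}. 0 \<le> u t) \<or> (\<forall>t\<in>{x<..}. u t \<le> 0)" ..
    next
      assume "\<forall>x\<in>?I. b < x \<longrightarrow> u x \<le> 0"
      then have "\<forall>t\<in>{x<..}. u t \<le> 0" using u(3) that by (metis greaterThan_iff less_trans order_refl)
      then show "(\<forall>t\<in>{x<..}. 0 \<le> u t) \<or> (\<forall>t\<in>{x<..}. u t \<le> 0)" ..
    qed
    finally show ?thesis by (simp add: upper)
  qed
  have A_left: "A x \<le> \<bar>U x\<bar>" if "x < a" for x
  proof -
    have "A x = (LINT t:{..x}|lborel. \<bar>u t\<bar>)"
      unfolding A_def set_lebesgue_integral_def using that y(3)
      by (intro Bochner_Integration.integral_cong) (auto simp: K_lower abs_mult)
    also have "\<dots> \<le> \<bar>LINT t:{..x}|lborel. u t\<bar>"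
    proof (rule set_le, use left in \<open>elim disjE\<close>)
      assume "\<forall>x\<in>?I. x < a \<longrightarrow> 0 \<le> u x"
      then have "\<forall>t\<in>{..x}. 0 \<le> u t" using u(3) that by (metis atMost_iff le_less_trans order_refl)
      then show "(\<forall>t\<in>{..x}. 0 \<le> u t) \<or> (\<forall>t\<in>{..x}. u t \<le> 0)" ..
    next
      assume "\<forall>x\<in>?I. x < a \<longrightarrow> u x \<le> 0"
      then have "\<forall>t\<in>{..x}. u t \<le> 0" using u(3) that by (metis atMost_iff le_less_trans order_refl)
      then show "(\<forall>t\<in>{..x}. 0 \<le> u t) \<or> (\<forall>t\<in>{..x}. u t \<le> 0)" ..
    qed
    finally show ?thesis by (simp add: U)
  qed
  have F_meas [measurable]: "F \<in> borel_measurable (lborel \<Otimes>\<^sub>M lborel)"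
    unfolding F_def K_def by measurable
  \<comment> \<open>On \<open>{a..b}\<close> the inner integral \<open>A x\<close> is at most the
    integral of \<open>\<bar>u\<bar>\<close> and \<open>h'\<close> is integrable there; outside,
    constancy of sign gives \<open>A x \<le> \<bar>U x\<bar>\<close>, and \<open>h' U\<close> is
    integrable by assumption.\<close>
  have F_int: "integrable (lborel \<Otimes>\<^sub>M lborel) F"
  proof (rule lborel_pair.Fubini_integrable[OF F_meas])
    have eq: "(\<integral>t. norm (F (x, t)) \<partial>lborel) = \<bar>h' x\<bar> * A x" for x
      by (simp add: F_def A_def abs_mult)
    show "integrable lborel (\<lambda>x. \<integral>t. norm (F (x, t)) \<partial>lborel)"
    proof (rule Bochner_Integration.integrable_bound)
      let ?C = "\<integral>t. \<bar>u t\<bar> \<partial>lborel"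
      show "integrable lborel (\<lambda>x. \<bar>h' x * U x\<bar> + ?C * \<bar>indicator {a..b} x *\<^sub>R h' x\<bar>)"
        using int h'_loc[OF y(1,2)] y(3,4)
        by (intro Bochner_Integration.integrable_add integrable_abs integrable_mult_right)
          (auto simp: set_integrable_def)
      show "AE x in lborel. norm (\<integral>t. norm (F (x, t)) \<partial>lborel)
          \<le> norm (\<bar>h' x * U x\<bar> + ?C * \<bar>indicator {a..b} x *\<^sub>R h' x\<bar>)"
      proof (rule AE_I2)
        fix x
        have C: "0 \<le> ?C" by (rule integral_nonneg_AE) simp
        have A0: "0 \<le> A x" unfolding A_def by (rule integral_nonneg_AE) simp
        have "\<bar>h' x\<bar> * A x \<le> \<bar>h' x * U x\<bar> + ?C * \<bar>indicator {a..b} x *\<^sub>R h' x\<bar>"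
        proof (cases "x \<in> {a..b}")
          case True
          then show ?thesis
            using mult_left_mono[OF A_le[of x] abs_ge_zero[of "h' x"]] by (simp add: mult.commute)
        next
          case False
          then have "A x \<le> \<bar>U x\<bar>" using A_left[of x] A_right[of x] by force
          then show ?thesis using False by (simp add: abs_mult mult_left_mono)
        qed
        then show "norm (\<integral>t. norm (F (x, t)) \<partial>lborel)
          \<le> norm (\<bar>h' x * U x\<bar> + ?C * \<bar>indicator {a..b} x *\<^sub>R h' x\<bar>)"
          unfolding eq using A0 C by simp
      qed
    qed measurable
    show "AE x in lborel. integrable lborel (\<lambda>t. F (x, t))"
      using int_K by (auto simp: F_def)
  qed
  have K_h': "(\<integral>x. h' x * K x t \<partial>lborel) = h t - h y" if t: "t \<in> ?I" for t
  proof (cases "y < t")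
    case True
    have "(\<integral>x. h' x * K x t \<partial>lborel) = (LINT x:{y..t}|lborel. h' x)"
      unfolding set_lebesgue_integral_def
    proof (rule integral_cong_AE)
      have "AE x in lborel. x \<noteq> y" "AE x in lborel. x \<noteq> t" by (rule AE_lborel_singleton)+
      then show "AE x in lborel. h' x * K x t = indicator {y..t} x *\<^sub>R h' x"
        by eventually_elim (use True in \<open>auto simp: K_def split: split_indicator\<close>)
    qed (auto simp: K_def)
    then show ?thesis using ftc[OF yI t] True by simp
  next
    case False
    have "(\<integral>x. h' x * K x t \<partial>lborel) = - (LINT x:{t..y}|lborel. h' x)"
      unfolding set_lebesgue_integral_def integral_minus[symmetric]
      by (rule Bochner_Integration.integral_cong)
        (use False in \<open>auto simp: K_def split: split_indicator\<close>)
    then show ?thesis using ftc[OF t yI] False by simp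
  qed
  \<comment> \<open>Outside the interval both sides vanish with \<open>u\<close>. The base value
    \<open>h y\<close> disappears afterwards because \<open>u\<close> has integral 0.\<close>
  have F_snd: "(\<integral>x. F (x, t) \<partial>lborel) = u t * h t - h y * u t" for t
  proof (cases "t \<in> ?I")
    case True
    have "(\<integral>x. F (x, t) \<partial>lborel) = (\<integral>x. u t * (h' x * K x t) \<partial>lborel)"
      by (simp add: F_def mult_ac)
    also have "\<dots> = u t * (h t - h y)" by (simp only: integral_mult_right_zero K_h'[OF True])
    finally show ?thesis by (simp add: algebra_simps)
  next
    case False
    then show ?thesis using u(3)[OF False] by (simp add: F_def)
  qed
  have int_snd: "integrable lborel (\<lambda>t. u t * h t - h y * u t)"
    using lborel_pair.integrable_snd[OF F_int[unfolded F_def]] F_snd by (simp add: F_def)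
  have "integrable lborel (\<lambda>t. (u t * h t - h y * u t) + h y * u t)"
    using u(1) by (intro Bochner_Integration.integrable_add int_snd) auto
  then show *: "integrable lborel (\<lambda>t. u t * h t)" by simp
  have "(\<integral>t. u t * h t \<partial>lborel) = (\<integral>t. u t * h t - h y * u t \<partial>lborel)"
    using * u(1,2) by simp
  also have "\<dots> = (\<integral>t. (\<integral>x. F (x, t) \<partial>lborel) \<partial>lborel)" by (simp add: F_snd)
  also have "\<dots> = (\<integral>x. (\<integral>t. F (x, t) \<partial>lborel) \<partial>lborel)"
    using lborel_pair.Fubini_integral[of "\<lambda>x t. F (x, t)"] F_int by simp
  also have "\<dots> = - (\<integral>x. h' x * U x \<partial>lborel)"
    unfolding integral_minus[symmetric] by (simp add: F_def K_u)
  finally show "(\<integral>t. u t * h t \<partial>lborel) = - (\<integral>x. h' x * U x \<partial>lborel)" .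
qed

section \<open>Bessel's inequality with remainder\<close>

lemma integrable_mult_of_squares:
  fixes f g :: "'a \<Rightarrow> real"
  assumes [measurable]: "f \<in> borel_measurable M" "g \<in> borel_measurable M"
    and "integrable M (\<lambda>x. (f x)\<^sup>2)" "integrable M (\<lambda>x. (g x)\<^sup>2)"
  shows "integrable M (\<lambda>x. f x * g x)"
proof (rule Bochner_Integration.integrable_bound)
  show "integrable M (\<lambda>x. (f x)\<^sup>2 + (g x)\<^sup>2)" using assms by simp
  have "\<bar>f x * g x\<bar> \<le> (f x)\<^sup>2 + (g x)\<^sup>2" for x
    using sum_squares_bound[of "\<bar>f x\<bar>" "\<bar>g x\<bar>"] mult_nonneg_nonneg[of "\<bar>f x\<bar>" "\<bar>g x\<bar>"]
    unfolding abs_mult mult.assoc power2_abs by linarith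
  then show "AE x in M. norm (f x * g x) \<le> norm ((f x)\<^sup>2 + (g x)\<^sup>2)"
    by simp
qed measurable

text \<open>The remainder is kept because it decides the equality case. \<open>d k\<close> is the
  squared norm of \<open>\<phi> k\<close>, which is not normalised, and the residual
  \<open>W\<close> is orthogonal to the constants and to every \<open>\<phi> k\<close>.\<close>

lemma (in prob_space) variance_orthogonal_expansion:
  fixes Y :: "'a \<Rightarrow> real" and \<phi> :: "nat \<Rightarrow> 'a \<Rightarrow> real"
  assumes Y: "integrable M Y" "integrable M (\<lambda>\<omega>. (Y \<omega>)\<^sup>2)"
    and \<phi>: "\<And>k. k \<in> {1..n} \<Longrightarrow> \<phi> k \<in> borel_measurable M"
      "\<And>k. k \<in> {1..n} \<Longrightarrow> integrable M (\<lambda>\<omega>. (\<phi> k \<omega>)\<^sup>2)"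
      "\<And>k. k \<in> {1..n} \<Longrightarrow> expectation (\<phi> k) = 0"
      "\<And>j k. j \<in> {1..n} \<Longrightarrow> k \<in> {1..n} \<Longrightarrow> expectation (\<lambda>\<omega>. \<phi> j \<omega> * \<phi> k \<omega>) = (if j = k then d k else 0)"
    and d: "\<And>k. k \<in> {1..n} \<Longrightarrow> 0 < d k"
  defines "c \<equiv> \<lambda>k. expectation (\<lambda>\<omega>. \<phi> k \<omega> * Y \<omega>)"
  defines "W \<equiv> \<lambda>\<omega>. Y \<omega> - expectation Y - (\<Sum>k=1..n. c k / d k * \<phi> k \<omega>)"
  shows "integrable M (\<lambda>\<omega>. (W \<omega>)\<^sup>2)"
    and "variance Y = (\<Sum>k=1..n. (c k)\<^sup>2 / d k) + expectation (\<lambda>\<omega>. (W \<omega>)\<^sup>2)"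
    and "\<And>k. k \<in> {1..n} \<Longrightarrow> expectation (\<lambda>\<omega>. \<phi> k \<omega> * W \<omega>) = 0"
    and "expectation W = 0"
proof -
  have Y_meas [measurable]: "Y \<in> borel_measurable M" using Y(1) by simp
  have int_\<phi>: "integrable M (\<phi> k)" if "k \<in> {1..n}" for k
    using integrable_mult_of_squares[of "\<phi> k" M "\<lambda>_. 1"] \<phi>(1,2)[OF that] by simp
  have int_\<phi>\<phi>: "integrable M (\<lambda>\<omega>. \<phi> j \<omega> * \<phi> k \<omega>)" if "j \<in> {1..n}" "k \<in> {1..n}" for j k
    using that \<phi>(1,2) by (intro integrable_mult_of_squares) auto
  have int_\<phi>Y: "integrable M (\<lambda>\<omega>. \<phi> k \<omega> * Y \<omega>)" if "k \<in> {1..n}" for k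
    using that \<phi>(1,2) Y by (intro integrable_mult_of_squares) auto
  define a where "a k = c k / d k" for k
  have a: "a k * d k = c k" if "k \<in> {1..n}" for k using d[OF that] by (simp add: a_def)
  define m where "m = expectation Y"
  have W: "W \<omega> = Y \<omega> - m - (\<Sum>k=1..n. a k * \<phi> k \<omega>)" for \<omega> by (simp add: W_def a_def m_def)
  have int_S: "integrable M (\<lambda>\<omega>. \<Sum>k=1..n. a k * \<phi> k \<omega>)"
    using int_\<phi> by (intro Bochner_Integration.integrable_sum integrable_mult_right) auto
  have E_S: "expectation (\<lambda>\<omega>. \<Sum>k=1..n. a k * \<phi> k \<omega>) = 0"
    using int_\<phi> \<phi>(3) by (subst Bochner_Integration.integral_sum) auto
  have int_W: "integrable M W" unfolding W using Y int_S by auto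
  show E_W: "expectation W = 0"
    unfolding W using Y int_S E_S by (simp add: m_def prob_space)
  have \<phi>W_eq: "\<phi> k \<omega> * W \<omega> = \<phi> k \<omega> * Y \<omega> - m * \<phi> k \<omega> - (\<Sum>j=1..n. a j * (\<phi> k \<omega> * \<phi> j \<omega>))" for k \<omega>
    by (simp add: W algebra_simps sum_distrib_left)
  have int_\<phi>W: "integrable M (\<lambda>\<omega>. \<phi> k \<omega> * W \<omega>)" if "k \<in> {1..n}" for k
    unfolding \<phi>W_eq using int_\<phi>Y int_\<phi> int_\<phi>\<phi> that
    by (intro Bochner_Integration.integrable_diff integrable_mult_right Bochner_Integration.integrable_sum)
  show E_\<phi>W: "expectation (\<lambda>\<omega>. \<phi> k \<omega> * W \<omega>) = 0" if k: "k \<in> {1..n}" for k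
  proof -
    have "expectation (\<lambda>\<omega>. \<Sum>j=1..n. a j * (\<phi> k \<omega> * \<phi> j \<omega>)) = (\<Sum>j=1..n. a j * (if k = j then d j else 0))"
      using int_\<phi>\<phi> \<phi>(4) k by (subst Bochner_Integration.integral_sum) auto
    also have "\<dots> = (\<Sum>j=1..n. if k = j then a j * d j else 0)"
      by (intro sum.cong) auto
    also have "\<dots> = c k" using k a by simp
    finally have S: "expectation (\<lambda>\<omega>. \<Sum>j=1..n. a j * (\<phi> k \<omega> * \<phi> j \<omega>)) = c k" .
    have "integrable M (\<lambda>\<omega>. \<Sum>j=1..n. a j * (\<phi> k \<omega> * \<phi> j \<omega>))"
      using int_\<phi>\<phi> k by auto
    then show ?thesis
      unfolding \<phi>W_eq using int_\<phi>Y[OF k] int_\<phi>[OF k] \<phi>(3)[OF k] S by (simp add: c_def)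
  qed
  \<comment> \<open>Written this way, the square of \<open>W\<close> is a combination of terms
    already known to be integrable. In expectation only the variance and the sum with
    \<open>\<phi> k * Y\<close> survive, since \<open>S\<close> has mean 0 and is orthogonal to
    \<open>W\<close>.\<close>
  have sq: "(Y \<omega> - m)\<^sup>2 - (\<Sum>k=1..n. a k * (\<phi> k \<omega> * Y \<omega>)) + m * (\<Sum>k=1..n. a k * \<phi> k \<omega>)
      - (\<Sum>k=1..n. a k * (\<phi> k \<omega> * W \<omega>)) = (W \<omega>)\<^sup>2" for \<omega>
  proof -
    define S where "S = (\<Sum>k=1..n. a k * \<phi> k \<omega>)"
    have sums: "(\<Sum>k=1..n. a k * (\<phi> k \<omega> * Y \<omega>)) = S * Y \<omega>" "(\<Sum>k=1..n. a k * (\<phi> k \<omega> * W \<omega>)) = S * W \<omega>"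
      by (simp_all add: S_def sum_distrib_right mult.assoc)
    have Y_eq: "Y \<omega> = W \<omega> + m + S" by (simp add: W S_def)
    show ?thesis
      unfolding sums S_def[symmetric] unfolding Y_eq by (simp add: power2_eq_square algebra_simps)
  qed
  have int_sums: "integrable M (\<lambda>\<omega>. \<Sum>k=1..n. a k * (\<phi> k \<omega> * Y \<omega>))"
    "integrable M (\<lambda>\<omega>. \<Sum>k=1..n. a k * (\<phi> k \<omega> * W \<omega>))"
    "integrable M (\<lambda>\<omega>. (Y \<omega> - m)\<^sup>2)"
    using int_\<phi>Y int_\<phi>W Y by (auto simp: power2_diff)
  show "integrable M (\<lambda>\<omega>. (W \<omega>)\<^sup>2)"
    unfolding sq[symmetric] using int_sums int_S by auto
  have "expectation (\<lambda>\<omega>. (W \<omega>)\<^sup>2) = variance Y - (\<Sum>k=1..n. a k * c k)"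
  proof -
    have "expectation (\<lambda>\<omega>. \<Sum>k=1..n. a k * (\<phi> k \<omega> * Y \<omega>)) = (\<Sum>k=1..n. a k * c k)"
      using int_\<phi>Y by (subst Bochner_Integration.integral_sum) (auto simp: c_def)
    moreover have "expectation (\<lambda>\<omega>. \<Sum>k=1..n. a k * (\<phi> k \<omega> * W \<omega>)) = 0"
      using int_\<phi>W E_\<phi>W by (subst Bochner_Integration.integral_sum) auto
    ultimately show ?thesis
      unfolding sq[symmetric] using int_sums int_S E_S by (simp add: m_def)
  qed
  then show "variance Y = (\<Sum>k=1..n. (c k)\<^sup>2 / d k) + expectation (\<lambda>\<omega>. (W \<omega>)\<^sup>2)"
    by (simp add: a_def power2_eq_square)
qed

subsection \<open>Pearson densities\<close>

text \<open>Everything is phrased with Lebesgue integrals against \<open>f\<close>, so that the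
  analysis refers to neither \<open>X\<close> nor its probability space.\<close>

locale pearson =
  fixes f :: "real \<Rightarrow> real" and \<mu> \<delta> \<beta> \<gamma> :: real and r s :: ereal and n :: nat
  assumes f_measurable [measurable]: "f \<in> borel_measurable borel"
    and f_nonneg: "\<And>x. 0 \<le> f x"
    and f_total: "(\<integral>x. f x \<partial>lborel) = 1"
    and n_pos: "1 \<le> n"
    and moment: "integrable lborel (\<lambda>x. f x * \<bar>x\<bar> ^ (2 * n))"
    and mean: "(\<integral>x. f x * x \<partial>lborel) = \<mu>"
    and pearson_eq: "\<And>x. (LINT t:{..x}|lborel. (\<mu> - t) * f t) = (\<delta> * x\<^sup>2 + \<beta> * x + \<gamma>) * f x"
    and support: "{x. 0 < f x} = einterval r s"
begin

abbreviation I :: "real set" where "I \<equiv> einterval r s"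

definition Q :: "real poly" where "Q = [:\<gamma>, \<beta>, \<delta>:]"

lemma poly_Q: "poly Q x = \<delta> * x\<^sup>2 + \<beta> * x + \<gamma>"
  by (simp add: Q_def power2_eq_square algebra_simps)

lemma f_eq_0: "x \<notin> I \<Longrightarrow> f x = 0"
  using support f_nonneg by (metis less_eq_real_def mem_Collect_eq)

lemma f_pos: "x \<in> I \<Longrightarrow> 0 < f x"
  using support by blast

lemma f_integrable: "integrable lborel f"
  \<comment> \<open>A non-integrable function has Bochner integral 0, so total mass 1 forces
    integrability.\<close>
  using f_total not_integrable_integral_eq by fastforce

lemma I_nonempty: "I \<noteq> {}"
proof
  assume "I = {}"
  then have "f = (\<lambda>_. 0)" using f_eq_0 by auto
  then show False using f_total by simp
qed

lemma poly_integrable: 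
  assumes "degree P \<le> 2 * n"
  shows "integrable lborel (\<lambda>x. f x * poly P x)"
proof -
  have "integrable lborel (\<lambda>x. f x * x ^ i)" if "i \<le> 2 * n" for i
  proof (rule Bochner_Integration.integrable_bound)
    show "integrable lborel (\<lambda>x. f x + f x * \<bar>x\<bar> ^ (2 * n))"
      using f_integrable moment by auto
    show "AE x in lborel. norm (f x * x ^ i) \<le> norm (f x + f x * \<bar>x\<bar> ^ (2 * n))"
    proof (rule AE_I2)
      fix x :: real
      have "\<bar>x\<bar> ^ i \<le> 1 + \<bar>x\<bar> ^ (2 * n)"
      proof (cases "\<bar>x\<bar> \<le> 1")
        case True
        then show ?thesis using power_le_one[of "\<bar>x\<bar>" i] by (simp add: add_increasing2)
      next
        case False
        then have "\<bar>x\<bar> ^ i \<le> \<bar>x\<bar> ^ (2 * n)" by (intro power_increasing that) simp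
        then show ?thesis by linarith
      qed
      from mult_left_mono[OF this f_nonneg[of x]]
      show "norm (f x * x ^ i) \<le> norm (f x + f x * \<bar>x\<bar> ^ (2 * n))"
        using f_nonneg[of x] by (simp add: abs_mult power_abs algebra_simps)
    qed
  qed auto
  then have "integrable lborel (\<lambda>x. \<Sum>i\<le>degree P. coeff P i * (f x * x ^ i))"
    using assms by (intro Bochner_Integration.integrable_sum integrable_mult_right) auto
  also have "(\<lambda>x. \<Sum>i\<le>degree P. coeff P i * (f x * x ^ i)) = (\<lambda>x. f x * poly P x)"
    by (simp add: poly_altdef sum_distrib_left algebra_simps)
  finally show ?thesis .
qed

text \<open>A point outside the interval lies on one side of it, which would give the integral of
  \<open>(x - m) w\<close> a strict sign. Applied to \<open>f\<close> itself and to the weight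
  \<open>q^(n-1) f\<close>.\<close>

lemma weighted_mean_in_I:
  assumes w: "\<And>x. 0 \<le> w x" "\<And>x. x \<in> I \<Longrightarrow> 0 < w x" "\<And>x. x \<notin> I \<Longrightarrow> w x = 0"
    and int: "integrable lborel w" "integrable lborel (\<lambda>x. x * w x)"
    and m: "(\<integral>x. x * w x \<partial>lborel) = m * (\<integral>x. w x \<partial>lborel)"
  shows "m \<in> I"
proof (rule ccontr)
  assume "m \<notin> I"
  then consider "\<And>x. x \<in> I \<Longrightarrow> m < x" | "\<And>x. x \<in> I \<Longrightarrow> x < m"
    unfolding einterval_iff by (metis ereal_less_eq(3) le_less_trans less_le_trans not_le)
  then show False
  proof cases
    case 1
    have "0 < (\<integral>x. x * w x - m * w x \<partial>lborel)"
    proof (rule integral_pos_open[of _ I])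
      show "0 < x * w x - m * w x" if "x \<in> I" for x
        using w(2)[OF that] 1[OF that] by simp
      then show "0 \<le> x * w x - m * w x" for x
        using w(3)[of x] by (cases "x \<in> I") (auto simp: less_imp_le)
    qed (use int I_nonempty in auto)
    then show False using int m by simp
  next
    case 2
    have "0 < (\<integral>x. m * w x - x * w x \<partial>lborel)"
    proof (rule integral_pos_open[of _ I])
      show "0 < m * w x - x * w x" if "x \<in> I" for x
        using w(2)[OF that] 2[OF that] by simp
      then show "0 \<le> m * w x - x * w x" for x
        using w(3)[of x] by (cases "x \<in> I") (auto simp: less_imp_le)
    qed (use int I_nonempty in auto)
    then show False using int m by simp
  qed
qed

lemma mean_in_I: "\<mu> \<in> I"
  using weighted_mean_in_I[of f \<mu>] f_nonneg f_pos f_eq_0 f_integrable f_total mean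
    poly_integrable[of "[:0, 1:]"] n_pos
  by (simp add: mult.commute)

section \<open>The function \<open>G = q f\<close>: positivity, regularity, decay at
  infinity\<close>

definition G :: "real \<Rightarrow> real" where "G x = poly Q x * f x"

lemma deviation_integrable: "integrable lborel (\<lambda>t. (\<mu> - t) * f t)"
  using poly_integrable[of "[:\<mu>, -1:]"] n_pos by (simp add: algebra_simps)

lemma deviation_integral: "(\<integral>t. (\<mu> - t) * f t \<partial>lborel) = 0"
proof -
  have "integrable lborel (\<lambda>t. f t * t)" using poly_integrable[of "[:0, 1:]"] n_pos by simp
  then have "(\<integral>t. \<mu> * f t - f t * t \<partial>lborel) = 0"
    using f_integrable f_total mean by simp
  then show ?thesis by (simp add: algebra_simps)
qed

lemma G_eq: "G x = (LINT t:{..x}|lborel. (\<mu> - t) * f t)"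
  by (simp add: G_def pearson_eq poly_Q)

lemma G_eq_upper: "G x = (LINT t:{x<..}|lborel. (t - \<mu>) * f t)"
proof -
  note int = set_integrable_of_integrable[OF deviation_integrable]
  have "0 = (LINT t:{..x} \<union> {x<..}|lborel. (\<mu> - t) * f t)"
    using deviation_integral unfolding atMost_Un_greaterThan by (simp add: set_lebesgue_integral_def)
  also have "\<dots> = G x + (LINT t:{x<..}|lborel. (\<mu> - t) * f t)"
    unfolding G_eq by (subst set_integral_Un) (auto intro: int)
  also have "(LINT t:{x<..}|lborel. (\<mu> - t) * f t) = - (LINT t:{x<..}|lborel. (t - \<mu>) * f t)"
    unfolding set_lebesgue_integral_def integral_minus[symmetric]
    by (intro Bochner_Integration.integral_cong) (auto simp: algebra_simps)
  finally show ?thesis by simp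
qed

text \<open>It suffices that \<open>G x > 0\<close>. For \<open>x \<le> \<mu>\<close> the integrand
  over \<open>{..x}\<close> is nonnegative, and positive on the part of the support below
  \<open>x\<close>; for \<open>x > \<mu>\<close> the complementary integral over
  \<open>{x<..}\<close> plays the same role.\<close>

lemma Q_pos:
  assumes x: "x \<in> I"
  shows "0 < poly Q x"
proof -
  have int: "integrable lborel (\<lambda>t. indicator A t *\<^sub>R ((\<mu> - t) * f t))"
    "integrable lborel (\<lambda>t. indicator A t *\<^sub>R ((t - \<mu>) * f t))" if "A \<in> sets lborel" for A :: "real set"
  proof -
    have "integrable lborel (\<lambda>t. (t - \<mu>) * f t)"
      using integrable_minus[OF deviation_integrable] by (simp add: left_diff_distrib)
    then show "integrable lborel (\<lambda>t. indicator A t *\<^sub>R ((\<mu> - t) * f t))"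
      "integrable lborel (\<lambda>t. indicator A t *\<^sub>R ((t - \<mu>) * f t))"
      using that deviation_integrable by (auto intro!: integrable_mult_indicator simp del: real_scaleR_def)
  qed
  have "0 < G x"
  proof (cases "x \<le> \<mu>")
    case True
    have "{t\<in>I. t < x} = einterval r x"
      using x by (auto simp: einterval_iff less_ereal.simps(1)[symmetric] simp del: less_ereal.simps
          intro: less_trans)
    moreover have "einterval r x \<noteq> {}" using einterval_nonempty[of r x] x by (auto simp: einterval_iff)
    ultimately have S: "open {t\<in>I. t < x}" "{t\<in>I. t < x} \<noteq> {}" by auto
    show ?thesis
      unfolding G_eq set_lebesgue_integral_def
      by (rule integral_pos_open[OF int(1) _ S]) (use True f_pos f_nonneg in \<open>auto split: split_indicator\<close>)
  next
    case False
    have "{t\<in>I. x < t} = einterval x s"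
      using x by (auto simp: einterval_iff less_ereal.simps(1)[symmetric] simp del: less_ereal.simps
          intro: less_trans)
    moreover have "einterval x s \<noteq> {}" using einterval_nonempty[of x s] x by (auto simp: einterval_iff)
    ultimately have S: "open {t\<in>I. x < t}" "{t\<in>I. x < t} \<noteq> {}" by auto
    show ?thesis
      unfolding G_eq_upper set_lebesgue_integral_def
      by (rule integral_pos_open[OF int(2) _ S]) (use False f_pos f_nonneg in \<open>auto split: split_indicator\<close>)
  qed
  then show ?thesis using f_pos[OF x] by (simp add: G_def zero_less_mult_iff)
qed

lemma continuous_G: "continuous_on A G"
proof -
  have "isCont G x" for x
  proof -
    have "continuous_on {x - 1..x + 1} (\<lambda>u. G (x - 1) + integral {x - 1..u} (\<lambda>t. (\<mu> - t) * f t))"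
    proof (intro continuous_intros indefinite_integral_continuous_1)
      show "(\<lambda>t. (\<mu> - t) * f t) integrable_on {x - 1..x + 1}"
        using integrable_on_lborel[OF deviation_integrable] integrable_on_subinterval by blast
    qed
    then have "continuous_on {x - 1..x + 1} G"
      by (rule continuous_on_eq) (auto simp: G_eq intro!: set_integral_atMost_eq[OF deviation_integrable, symmetric])
    then show ?thesis by (rule continuous_on_interior) simp
  qed
  then show ?thesis by (simp add: continuous_at_imp_continuous_on)
qed

text \<open>The density is only assumed to be Borel; continuity on the support is inherited from
  \<open>G\<close> through \<open>f = G / q\<close>.\<close>

lemma continuous_f: "continuous_on I f"
proof -
  have "continuous_on I (\<lambda>x. G x / poly Q x)"
    using Q_pos by (intro continuous_intros continuous_G) force
  then show ?thesis
    by (rule continuous_on_eq) (use Q_pos in \<open>force simp: G_def\<close>)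
qed

text \<open>\<open>f\<close> may jump at a finite end of the support, hence the two excluded points.
  For an infinite end \<open>real_of_ereal\<close> returns the default 0, so 0 is excluded instead;
  finitely many exceptions do no harm in the fundamental theorem, as \<open>G\<close> is continuous
  everywhere.\<close>

lemma G_derivative:
  assumes "x \<noteq> real_of_ereal r" "x \<noteq> real_of_ereal s"
  shows "(G has_real_derivative (\<mu> - x) * f x) (at x)"
proof (cases "x \<in> I")
  case True
  then obtain e where e: "e > 0" "cball x e \<subseteq> I" using open_einterval open_contains_cball by blast
  then have sub: "{x - e..x + e} \<subseteq> I" by (simp add: cball_eq_atLeastAtMost)
  have "((\<lambda>u. integral {x - e..u} (\<lambda>t. (\<mu> - t) * f t)) has_vector_derivative (\<mu> - x) * f x)
      (at x within {x - e..x + e})"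
    using e(1) by (intro integral_has_vector_derivative continuous_intros
        continuous_on_subset[OF continuous_f sub]) auto
  then have "((\<lambda>u. G (x - e) + integral {x - e..u} (\<lambda>t. (\<mu> - t) * f t)) has_vector_derivative (\<mu> - x) * f x)
      (at x within {x - e..x + e})"
    by (auto intro!: derivative_eq_intros)
  then have "(G has_vector_derivative (\<mu> - x) * f x) (at x within {x - e..x + e})"
    by (rule has_vector_derivative_transform[rotated 2])
      (use e(1) in \<open>auto simp: G_eq intro!: set_integral_atMost_eq[OF deviation_integrable]\<close>)
  moreover have "at x within {x - e..x + e} = at x"
    using e(1) by (intro at_within_Icc_at) auto
  ultimately show ?thesis
    by (simp only: has_real_derivative_iff_has_vector_derivative)
next
  case False
  define U where "U = {y. ereal y < r} \<union> {y. s < ereal y}"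
  have U: "open U" "x \<in> U"
    using False assms unfolding U_def einterval_iff
     apply (intro open_Un open_Collect_less continuous_intros)
    using False assms by (auto simp: einterval_iff not_less le_less)
  have "(G has_real_derivative 0) (at x)"
    by (rule has_field_derivative_transform_within_open[OF DERIV_const[of 0] U])
      (use f_eq_0 in \<open>force simp: U_def G_def einterval_iff\<close>)
  then show ?thesis using f_eq_0[OF False] by simp
qed

lemma G_tail_bound:
  "\<bar>G x\<bar> \<le> (LINT t:{..x}|lborel. \<bar>t - \<mu>\<bar> * f t)" "\<bar>G x\<bar> \<le> (LINT t:{x<..}|lborel. \<bar>t - \<mu>\<bar> * f t)"
proof -
  show "\<bar>G x\<bar> \<le> (LINT t:{..x}|lborel. \<bar>t - \<mu>\<bar> * f t)"
    unfolding G_eq set_lebesgue_integral_def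
    by (rule order_trans[OF integral_abs_bound])
      (auto simp: abs_mult f_nonneg abs_minus_commute intro!: eq_refl Bochner_Integration.integral_cong)
  show "\<bar>G x\<bar> \<le> (LINT t:{x<..}|lborel. \<bar>t - \<mu>\<bar> * f t)"
    unfolding G_eq_upper set_lebesgue_integral_def
    by (rule order_trans[OF integral_abs_bound])
      (auto simp: abs_mult f_nonneg abs_minus_commute intro!: eq_refl Bochner_Integration.integral_cong)
qed

text \<open>In the tail beyond \<open>x\<close> one has
  \<open>\<bar>x\<bar> ^ i \<le> \<bar>t\<bar> ^ i\<close>, so \<open>x ^ i * G x\<close> is
  dominated by a tail of the integral of
  \<open>\<bar>t\<bar> ^ i * \<bar>t - \<mu>\<bar> * f t\<close>. That is a moment of order
  \<open>i + 1\<close>, whence the bound \<open>i < 2 * n\<close>.\<close>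

lemma monomial_G_vanishes:
  assumes "i < 2 * n"
  shows "((\<lambda>x. x ^ i * G x) \<longlongrightarrow> 0) at_top" "((\<lambda>x. x ^ i * G x) \<longlongrightarrow> 0) at_bot"
proof -
  let ?h = "\<lambda>t. \<bar>f t * poly (monom 1 i * [:-\<mu>, 1:]) t\<bar>"
  have h_eq: "?h t = \<bar>t\<bar> ^ i * (\<bar>t - \<mu>\<bar> * f t)" for t
  proof -
    have "poly (monom 1 i * [:-\<mu>, 1:]) t = t ^ i * (t - \<mu>)"
      by (simp only: poly_mult poly_monom) simp
    then show ?thesis by (simp only: abs_mult power_abs abs_of_nonneg[OF f_nonneg] mult_ac)
  qed
  have "degree (monom 1 i * [:-\<mu>, 1:]) \<le> 2 * n"
    using degree_mult_le[of "monom 1 i" "[:-\<mu>, 1:]"] assms by (simp add: degree_monom_eq)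
  then have h: "integrable lborel ?h" using poly_integrable integrable_abs by blast
  have dev: "integrable lborel (\<lambda>t. \<bar>t - \<mu>\<bar> * f t)"
    using integrable_abs[OF deviation_integrable] by (simp add: abs_mult f_nonneg abs_minus_commute)
  have bound: "\<bar>x ^ i * G x\<bar> \<le> (LINT t:A|lborel. ?h t)"
    if A: "A \<in> sets borel" "\<bar>G x\<bar> \<le> (LINT t:A|lborel. \<bar>t - \<mu>\<bar> * f t)" "\<And>t. t \<in> A \<Longrightarrow> \<bar>x\<bar> \<le> \<bar>t\<bar>" for x A
  proof -
    have "\<bar>x ^ i * G x\<bar> \<le> \<bar>x\<bar> ^ i * (LINT t:A|lborel. \<bar>t - \<mu>\<bar> * f t)"
      using A(2) by (simp add: abs_mult power_abs mult_left_mono)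
    also have "\<dots> = (\<integral>t. indicator A t *\<^sub>R (\<bar>x\<bar> ^ i * (\<bar>t - \<mu>\<bar> * f t)) \<partial>lborel)"
      unfolding set_lebesgue_integral_def integral_mult_right_zero[symmetric]
      by (intro Bochner_Integration.integral_cong) auto
    also have "\<dots> \<le> (LINT t:A|lborel. ?h t)"
      unfolding set_lebesgue_integral_def
    proof (rule integral_mono)
      fix t
      show "indicator A t *\<^sub>R (\<bar>x\<bar> ^ i * (\<bar>t - \<mu>\<bar> * f t)) \<le> indicator A t *\<^sub>R ?h t"
        unfolding h_eq using A(3)[of t] f_nonneg[of t]
        by (auto split: split_indicator intro!: mult_right_mono power_mono)
    next
      show "integrable lborel (\<lambda>t. indicator A t *\<^sub>R (\<bar>x\<bar> ^ i * (\<bar>t - \<mu>\<bar> * f t)))"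
        using A(1) by (intro integrable_mult_indicator integrable_mult_right dev) simp
      show "integrable lborel (\<lambda>t. indicator A t *\<^sub>R ?h t)"
        using A(1) by (intro integrable_mult_indicator h) simp
    qed
    finally show ?thesis .
  qed
  have "((\<lambda>x. (\<integral>t. ?h t \<partial>lborel) - (LINT t:{..x}|lborel. ?h t)) \<longlongrightarrow> 0) at_top"
    using tendsto_diff[OF tendsto_const[of "\<integral>t. ?h t \<partial>lborel"] set_integral_atMost_at_top[OF h]]
    by (simp only: diff_self)
  moreover have "eventually (\<lambda>x. norm (x ^ i * G x) \<le> (\<integral>t. ?h t \<partial>lborel) - (LINT t:{..x}|lborel. ?h t)) at_top"
  proof (rule eventually_at_top_linorderI[of 0])
    fix x :: real assume "0 \<le> x"
    have "(\<integral>t. ?h t \<partial>lborel) = (LINT t:{..x} \<union> {x<..}|lborel. ?h t)"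
      unfolding atMost_Un_greaterThan by (simp add: set_lebesgue_integral_def)
    also have "\<dots> = (LINT t:{..x}|lborel. ?h t) + (LINT t:{x<..}|lborel. ?h t)"
      by (intro set_integral_Un set_integrable_of_integrable h) auto
    finally show "norm (x ^ i * G x) \<le> (\<integral>t. ?h t \<partial>lborel) - (LINT t:{..x}|lborel. ?h t)"
      using bound[OF _ G_tail_bound(2)[of x]] \<open>0 \<le> x\<close> by simp
  qed
  ultimately show "((\<lambda>x. x ^ i * G x) \<longlongrightarrow> 0) at_top"
    by (rule Lim_null_comparison[rotated])
  have "eventually (\<lambda>x. norm (x ^ i * G x) \<le> (LINT t:{..x}|lborel. ?h t)) at_bot"
  proof -
    have "norm (x ^ i * G x) \<le> (LINT t:{..x}|lborel. ?h t)" if "x \<le> 0" for x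
      using bound[OF _ G_tail_bound(1)[of x]] that by simp
    then show ?thesis unfolding eventually_at_bot_linorder by blast
  qed
  then show "((\<lambda>x. x ^ i * G x) \<longlongrightarrow> 0) at_bot"
    using set_integral_atMost_at_bot[OF h] by (rule Lim_null_comparison)
qed

lemma poly_G_vanishes:
  assumes "degree P < 2 * n"
  shows "((\<lambda>x. poly P x * G x) \<longlongrightarrow> 0) at_top" "((\<lambda>x. poly P x * G x) \<longlongrightarrow> 0) at_bot"
proof -
  have *: "((\<lambda>x. poly P x * G x) \<longlongrightarrow> 0) F"
    if "\<And>i. i < 2 * n \<Longrightarrow> ((\<lambda>x. x ^ i * G x) \<longlongrightarrow> 0) F" for F
  proof -
    have "((\<lambda>x. \<Sum>i\<le>degree P. coeff P i * (x ^ i * G x)) \<longlongrightarrow> (\<Sum>i\<le>degree P. coeff P i * 0)) F"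
      using assms that by (intro tendsto_intros) auto
    then show ?thesis by (simp add: poly_altdef sum_distrib_right mult.assoc)
  qed
  show "((\<lambda>x. poly P x * G x) \<longlongrightarrow> 0) at_top" "((\<lambda>x. poly P x * G x) \<longlongrightarrow> 0) at_bot"
    by (rule *, erule monomial_G_vanishes)+
qed

text \<open>The operator with \<open>(P G)' = f \<cdot> L P\<close>.\<close>

definition L :: "real poly \<Rightarrow> real poly" where
  "L P = pderiv P * Q + P * [:\<mu>, -1:]"

lemma degree_L: "degree (L P) \<le> Suc (degree P)"
proof -
  have "degree (pderiv P * Q) \<le> Suc (degree P)"
  proof (cases "degree P = 0")
    case True
    then have "pderiv P = 0" by (simp add: pderiv_eq_0_iff)
    then show ?thesis by simp
  next
    case False
    have "degree (pderiv P * Q) \<le> degree (pderiv P) + degree Q" by (rule degree_mult_le)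
    also have "\<dots> \<le> (degree P - 1) + 2" by (auto simp: degree_pderiv Q_def)
    finally show ?thesis using False by simp
  qed
  moreover have "degree (P * [:\<mu>, -1:]) \<le> Suc (degree P)"
    using degree_mult_le[of P "[:\<mu>, -1:]"] by simp
  ultimately show ?thesis unfolding L_def by (rule degree_add_le)
qed

text \<open>The difference \<open>J\<close> of the two sides is constant by the fundamental theorem
  and tends to 0 at minus infinity. Working with \<open>G\<close> on the whole line avoids boundary
  terms at \<open>r\<close> and \<open>s\<close>; only the decay at infinity enters.\<close>

lemma integral_L:
  assumes P: "degree P < 2 * n"
  shows "(LINT t:{..x}|lborel. f t * poly (L P) t) = poly P x * G x"
    and "(\<integral>t. f t * poly (L P) t \<partial>lborel) = 0"
proof -
  have int: "integrable lborel (\<lambda>t. f t * poly (L P) t)"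
    using P degree_L[of P] by (intro poly_integrable) simp
  define J where "J x = (LINT t:{..x}|lborel. f t * poly (L P) t) - poly P x * G x" for x
  have const: "J a = J b" if "a \<le> b" for a b
  proof -
    have "((\<lambda>t. f t * poly (L P) t) has_integral (poly P b * G b - poly P a * G a)) {a..b}"
    proof (rule fundamental_theorem_of_calculus_interior_strong)
      show "continuous_on {a..b} (\<lambda>x. poly P x * G x)"
        by (intro continuous_intros continuous_G)
      fix x assume "x \<in> {a<..<b} - {real_of_ereal r, real_of_ereal s}"
      then have "(G has_real_derivative (\<mu> - x) * f x) (at x)" using G_derivative by blast
      then have "((\<lambda>x. poly P x * G x) has_real_derivative poly (pderiv P) x * G x + poly P x * ((\<mu> - x) * f x)) (at x)"
        by (auto intro!: derivative_eq_intros)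
      also have "poly (pderiv P) x * G x + poly P x * ((\<mu> - x) * f x) = f x * poly (L P) x"
        by (simp add: L_def G_def algebra_simps)
      finally show "((\<lambda>x. poly P x * G x) has_vector_derivative f x * poly (L P) x) (at x)"
        by (simp add: has_real_derivative_iff_has_vector_derivative)
    qed (use that in auto)
    then show ?thesis
      using set_integral_atMost_eq[OF int that] by (simp add: J_def integral_unique)
  qed
  have "(J \<longlongrightarrow> 0 - 0) at_bot"
    unfolding J_def by (intro tendsto_diff set_integral_atMost_at_bot[OF int] poly_G_vanishes P)
  moreover have "eventually (\<lambda>y. J y = J x) at_bot" for x
    unfolding eventually_at_bot_linorder using const by blast
  ultimately have "J x = 0" for x
    using tendsto_eventually[of J "J x" at_bot] tendsto_unique[of at_bot J] by force
  then show *: "(LINT t:{..x}|lborel. f t * poly (L P) t) = poly P x * G x" for x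
    by (simp add: J_def)
  show "(\<integral>t. f t * poly (L P) t \<partial>lborel) = 0"
    using set_integral_atMost_at_top[OF int] poly_G_vanishes(1)[OF P]
    unfolding * by (intro tendsto_unique[of at_top]) auto
qed

text \<open>This is \<open>(\<mu> - x) + i q'(x)\<close>, the factor in
  \<open>(q^(i+1) f)' = q^i (drift i) f\<close>; for \<open>i = 0\<close> it is the original
  \<open>\<mu> - x\<close>.\<close>

definition drift :: "nat \<Rightarrow> real poly" where
  "drift i = [:\<mu> + real i * \<beta>, 2 * real i * \<delta> - 1:]"

lemma degree_Q_power: "degree (Q ^ i) \<le> 2 * i"
  using degree_power_le[of Q i] by (rule order_trans) (simp add: Q_def)

lemma L_Q_power_mult: "L (Q ^ i * P) = Q ^ i * (P * drift i + Q * pderiv P)"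
proof -
  have "drift i = [:\<mu>, -1:] + smult (real i) (pderiv Q)"
    by (simp add: drift_def Q_def pderiv_pCons)
  moreover have "pderiv (Q ^ i) * Q = Q ^ i * smult (real i) (pderiv Q)"
  proof (cases i)
    case (Suc j)
    show ?thesis unfolding Suc pderiv_power_Suc by (simp add: mult_ac del: of_nat_Suc)
  qed simp
  ultimately show ?thesis
    unfolding L_def pderiv_mult by (simp add: algebra_simps)
qed

text \<open>The weight \<open>w = q^i f\<close> is again of Pearson type, with mean \<open>m\<close> in \<open>(r, s)\<close>. Comparing
  \<open>\<integral> q w = a V\<close>, where \<open>V = \<integral> (x - m)\<^sup>2 w\<close> and \<open>a = 1 - 2 i \<delta>\<close>, with the expansion
  \<open>\<integral> q w = \<delta> V + q m \<integral> w\<close> gives \<open>\<delta> < a\<close>, because \<open>q m > 0\<close>.\<close>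

lemma delta_less: "(2 * real n - 1) * \<delta> < 1"
proof -
  \<comment> \<open>The largest exponent for which \<open>q^i x^2\<close> is guaranteed to have
    degree at most \<open>2 n\<close>, so that \<open>w\<close> has a second moment.\<close>
  define i where "i = n - 1"
  have n: "n = Suc i" using n_pos by (simp add: i_def)
  define w where "w x = f x * poly Q x ^ i" for x
  have w_pos: "0 < w x" if "x \<in> I" for x using f_pos Q_pos that by (simp add: w_def)
  have w_0: "w x = 0" if "x \<notin> I" for x using f_eq_0 that by (simp add: w_def)
  have w_nonneg: "0 \<le> w x" for x using w_pos[of x] w_0[of x] by (cases "x \<in> I") auto
  have int_w: "integrable lborel (\<lambda>x. x ^ j * w x)" if "j \<le> 2" for j
  proof -
    have "degree (Q ^ i * monom 1 j) \<le> 2 * n"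
      using degree_mult_le[of "Q ^ i" "monom 1 j"] degree_Q_power[of i] that n
      by (simp add: degree_monom_eq)
    from poly_integrable[OF this] show ?thesis
      by (simp add: w_def poly_monom mult_ac)
  qed
  define W where "W j = (\<integral>x. x ^ j * w x \<partial>lborel)" for j :: nat
  note int_w' = int_w[of 0, simplified] int_w[of 1, simplified] int_w[of 2, simplified]
  \<comment> \<open>\<open>drift i\<close> is the line \<open>b - a x\<close>, and \<open>T\<close>
    is the integral of \<open>q w\<close>. The polynomials \<open>q^i\<close> and
    \<open>q^i x\<close>, inserted into \<open>integral_L\<close>, yield the two relations
    below.\<close>
  define a b T where "a = 1 - 2 * real i * \<delta>" and "b = \<mu> + real i * \<beta>"
    and "T = \<delta> * W 2 + \<beta> * W 1 + \<gamma> * W 0"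
  have moments_W: "b * W 0 - a * W 1 = 0" "b * W 1 - a * W 2 + T = 0"
  proof -
    have "(\<integral>x. f x * poly (L (Q ^ i * 1)) x \<partial>lborel) = 0"
      using degree_Q_power[of i] n by (intro integral_L) simp
    then have "(\<integral>x. b * w x - a * (x * w x) \<partial>lborel) = 0"
      unfolding L_Q_power_mult by (simp add: drift_def w_def a_def b_def algebra_simps)
    then show "b * W 0 - a * W 1 = 0" using int_w' by (simp add: W_def)
    have "degree (Q ^ i * [:0, 1:]) < 2 * n"
      using degree_mult_le[of "Q ^ i" "[:0, 1:]"] degree_Q_power[of i] n by simp
    then have "(\<integral>x. f x * poly (L (Q ^ i * [:0, 1:])) x \<partial>lborel) = 0"
      by (rule integral_L)
    then have "(\<integral>x. b * (x * w x) - a * (x\<^sup>2 * w x)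
        + (\<delta> * (x\<^sup>2 * w x) + \<beta> * (x * w x) + \<gamma> * w x) \<partial>lborel) = 0"
      unfolding L_Q_power_mult
      by (simp add: drift_def w_def a_def b_def algebra_simps pderiv_pCons poly_Q power2_eq_square)
    then show "b * W 1 - a * W 2 + T = 0" using int_w' by (simp add: W_def T_def)
  qed
  have W0: "0 < W 0"
    unfolding W_def using int_w' w_pos w_nonneg I_nonempty by (intro integral_pos_open[of _ I]) auto
  have "0 < (\<integral>x. poly Q x * w x \<partial>lborel)"
  proof (rule integral_pos_open[of _ I])
    have "integrable lborel (\<lambda>x. \<delta> * (x\<^sup>2 * w x) + \<beta> * (x * w x) + \<gamma> * w x)"
      using int_w' by simp
    then show "integrable lborel (\<lambda>x. poly Q x * w x)"
      by (rule Bochner_Integration.integrable_cong[THEN iffD1, rotated -1]) (simp_all add: poly_Q algebra_simps)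
    show pos: "0 < poly Q x * w x" if "x \<in> I" for x using Q_pos w_pos that by simp
    show "0 \<le> poly Q x * w x" for x using pos[of x] w_0[of x] by (cases "x \<in> I") auto
  qed (use I_nonempty in auto)
  also have "(\<integral>x. poly Q x * w x \<partial>lborel) = (\<integral>x. \<delta> * (x\<^sup>2 * w x) + \<beta> * (x * w x) + \<gamma> * w x \<partial>lborel)"
    by (simp add: poly_Q algebra_simps)
  also have "\<dots> = T" using int_w' by (simp add: T_def W_def)
  finally have T: "0 < T" .
  have "a \<noteq> 0"
  proof
    assume "a = 0"
    then have "b = 0" using moments_W(1) W0 by simp
    then show False using moments_W(2) T \<open>a = 0\<close> by simp
  qed
  define m where "m = b / a"
  have b: "b = m * a" using \<open>a \<noteq> 0\<close> by (simp add: m_def)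
  have W1: "W 1 = m * W 0" using moments_W(1) \<open>a \<noteq> 0\<close> by (simp add: b)
  have "m \<in> I"
    by (rule weighted_mean_in_I[of w]) (use w_nonneg w_pos w_0 int_w' W1 in \<open>auto simp: W_def\<close>)
  then have qm: "0 < poly Q m" by (rule Q_pos)
  define V where "V = W 2 - m * W 1"
  have "V = (\<integral>x. (x - m)\<^sup>2 * w x \<partial>lborel)"
  proof -
    have "(\<integral>x. (x - m)\<^sup>2 * w x \<partial>lborel) = (\<integral>x. x\<^sup>2 * w x - 2 * m * (x * w x) + m\<^sup>2 * w x \<partial>lborel)"
      by (simp add: power2_eq_square algebra_simps)
    also have "\<dots> = W 2 - 2 * m * W 1 + m\<^sup>2 * W 0" using int_w' by (simp add: W_def)
    finally show ?thesis unfolding V_def using W1 by (simp add: power2_eq_square)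
  qed
  then have "0 \<le> V" using w_nonneg by (simp add: integral_nonneg_AE)
  have aV: "T = a * V" using moments_W(2) by (simp add: V_def b algebra_simps)
  have V: "0 < V" using \<open>0 \<le> V\<close> T aV by (metis less_eq_real_def mult_zero_right)
  have "T = \<delta> * V + poly Q m * W 0"
    unfolding T_def V_def using W1 by (simp add: poly_Q power2_eq_square algebra_simps)
  then have "(a - \<delta>) * V = poly Q m * W 0" using aV by (simp add: algebra_simps)
  then have "0 < (a - \<delta>) * V" using qm W0 by simp
  \<comment> \<open>With \<open>i = n - 1\<close> this says
    \<open>\<delta> < 1 - 2 (n - 1) \<delta>\<close>, which is the claim.\<close>
  then have "\<delta> < a" using V by (simp add: zero_less_mult_iff)
  then show ?thesis by (simp add: a_def n algebra_simps)
qed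

lemma index_delta_less:
  assumes "j \<le> 2 * n - 2"
  shows "real j * \<delta> < 1"
proof (cases "\<delta> \<le> 0")
  case True
  then show ?thesis by (smt (verit) mult_nonneg_nonpos of_nat_0_le_iff)
next
  case False
  have "real j \<le> 2 * real n - 1" using assms n_pos by linarith
  then have "real j * \<delta> \<le> (2 * real n - 1) * \<delta>" using False by (intro mult_right_mono) auto
  then show ?thesis using delta_less by simp
qed

text \<open>Since \<open>(Q^i P f)' = Q^(i-1) (P \<cdot> drift (i - 1) + Q P') f\<close>, the polynomial \<open>rodrigues k j\<close>
  is defined by \<open>(Q^k f)\<^sup>(\<^sup>j\<^sup>) = Q^(k-j) \<cdot> rodrigues k j \<cdot> f\<close> for \<open>j \<le> k\<close>.\<close>

fun rodrigues :: "nat \<Rightarrow> nat \<Rightarrow> real poly" where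
  "rodrigues k 0 = 1"
| "rodrigues k (Suc j) = rodrigues k j * drift (k - Suc j) + Q * pderiv (rodrigues k j)"

definition \<phi> :: "nat \<Rightarrow> real poly" where "\<phi> k = smult ((-1) ^ k) (rodrigues k k)"

definition lc :: "nat \<Rightarrow> real" where "lc k = (\<Prod>j=k-1..2*k-2. 1 - real j * \<delta>)"

section \<open>Degrees and leading coefficients of the Rodrigues polynomials\<close>

lemma degree_rodrigues: "degree (rodrigues k j) \<le> j"
proof (induction j)
  case (Suc j)
  have "degree (rodrigues k j * drift (k - Suc j)) \<le> Suc j"
    by (rule order_trans[OF degree_mult_le]) (use Suc in \<open>simp add: drift_def\<close>)
  moreover have "degree (Q * pderiv (rodrigues k j)) \<le> Suc j"
  proof (cases "degree (rodrigues k j) = 0")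
    case True
    then have "pderiv (rodrigues k j) = 0" by (simp add: pderiv_eq_0_iff)
    then show ?thesis by simp
  next
    case False
    have "degree (Q * pderiv (rodrigues k j)) \<le> 2 + (degree (rodrigues k j) - 1)"
      using degree_mult_le[of Q "pderiv (rodrigues k j)"] by (simp add: degree_pderiv Q_def split: if_splits)
    then show ?thesis using False Suc by simp
  qed
  ultimately show ?case by (simp add: degree_add_le)
qed simp

text \<open>Passing from \<open>j\<close> to \<open>Suc j\<close>, \<open>drift\<close> contributes
  the factor \<open>2 (k - j - 1) \<delta> - 1\<close> and \<open>Q * pderiv\<close> contributes
  \<open>j \<delta>\<close>; their sum is \<open>- (1 - (2 k - 2 - j) \<delta>)\<close>.\<close>

lemma coeff_rodrigues:
  assumes "j \<le> k"
  shows "coeff (rodrigues k j) j = (-1) ^ j * (\<Prod>i<j. 1 - real (2 * k - 2 - i) * \<delta>)"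
  using assms
proof (induction j)
  case (Suc j)
  define c where "c = coeff (rodrigues k j) j"
  have "coeff (rodrigues k j * drift (k - Suc j)) (j + 1) = c * (2 * real (k - Suc j) * \<delta> - 1)"
    unfolding c_def by (subst coeff_mult_bound[OF degree_rodrigues]) (auto simp: drift_def)
  moreover have "coeff (Q * pderiv (rodrigues k j)) (j + 1) = \<delta> * (real j * c)"
  proof (cases j)
    case 0
    then show ?thesis by simp
  next
    case j: (Suc l)
    have "degree (pderiv (rodrigues k j)) \<le> l"
      using degree_rodrigues[of k j] j by (simp add: degree_pderiv)
    moreover have "degree Q \<le> 2" by (simp add: Q_def)
    ultimately have "coeff (Q * pderiv (rodrigues k j)) (2 + l) = coeff Q 2 * coeff (pderiv (rodrigues k j)) l"
      using coeff_mult_bound by blast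
    then show ?thesis using j by (simp add: Q_def coeff_pderiv c_def numeral_2_eq_2)
  qed
  ultimately have "coeff (rodrigues k (Suc j)) (Suc j) = - c * (1 - real (2 * k - 2 - j) * \<delta>)"
    using Suc.prems by (simp add: of_nat_diff algebra_simps)
  also have "\<dots> = (-1) ^ Suc j * (\<Prod>i<Suc j. 1 - real (2 * k - 2 - i) * \<delta>)"
    using Suc by (simp add: c_def)
  finally show ?case .
qed simp

lemma degree_phi: "degree (\<phi> k) \<le> k"
  unfolding \<phi>_def using degree_rodrigues[of k k] by simp

lemma coeff_phi: "coeff (\<phi> k) k = lc k"
proof -
  have "coeff (\<phi> k) k = (\<Prod>i<k. 1 - real (2 * k - 2 - i) * \<delta>)"
    by (simp add: \<phi>_def coeff_rodrigues flip: power_mult_distrib mult.assoc)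
  also have "\<dots> = lc k"
  proof (cases k)
    case (Suc l)
    show ?thesis
      unfolding lc_def
      by (rule prod.reindex_bij_witness[of _ "\<lambda>j. 2 * k - 2 - j" "\<lambda>i. 2 * k - 2 - i"]) (auto simp: Suc)
  \<comment> \<open>For \<open>k = 0\<close> truncated subtraction turns the range into
    \<open>{0..0}\<close>, whose only factor is \<open>1 - 0 * \<delta> = 1\<close>.\<close>
  qed (simp add: lc_def)
  finally show ?thesis .
qed

lemma lc_pos: "k \<le> n \<Longrightarrow> 0 < lc k"
  unfolding lc_def by (intro prod_pos) (auto intro!: index_delta_less)

text \<open>Integration by parts with \<open>U = P G\<close> and \<open>u = f (L P)\<close> for
  \<open>P = q^(k-j-1) rodrigues k j\<close>. Integrability passes from the higher derivative to the
  lower one. As \<open>f\<close> and \<open>q\<close> are positive on \<open>I\<close>, the sign of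
  \<open>u\<close> there is that of \<open>rodrigues k (Suc j)\<close>.\<close>

lemma integral_rodrigues_step:
  fixes h h' :: "real \<Rightarrow> real"
  assumes kn: "k \<le> n" and jk: "j < k"
    and h'_meas: "h' \<in> borel_measurable borel"
    and h'_loc: "\<And>c d. c \<in> I \<Longrightarrow> d \<in> I \<Longrightarrow> c \<le> d \<Longrightarrow> set_integrable lborel {c..d} h'"
    and ftc: "\<And>c d. c \<in> I \<Longrightarrow> d \<in> I \<Longrightarrow> c \<le> d \<Longrightarrow> (LINT x:{c..d}|lborel. h' x) = h d - h c"
    and int: "integrable lborel (\<lambda>x. f x * (poly (Q ^ (k - j) * rodrigues k j) x * h' x))"
  shows "integrable lborel (\<lambda>x. f x * (poly (Q ^ (k - Suc j) * rodrigues k (Suc j)) x * h x))"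
    and "(\<integral>x. f x * (poly (Q ^ (k - Suc j) * rodrigues k (Suc j)) x * h x) \<partial>lborel)
       = - (\<integral>x. f x * (poly (Q ^ (k - j) * rodrigues k j) x * h' x) \<partial>lborel)"
proof -
  define i where "i = k - Suc j"
  have i: "k - j = Suc i" using jk by (simp add: i_def)
  define P where "P = Q ^ i * rodrigues k j"
  have LP: "L P = Q ^ i * rodrigues k (Suc j)"
    by (simp add: P_def L_Q_power_mult i_def)
  have "degree P \<le> 2 * i + j"
    unfolding P_def using degree_mult_le degree_Q_power degree_rodrigues
    by (meson add_mono order_trans)
  \<comment> \<open>\<open>2 * i + j = 2 * k - 2 - j\<close>, which is below
    \<open>2 * n\<close>.\<close>
  then have P: "degree P < 2 * n" using i kn by linarith
  define u where "u x = f x * poly (L P) x" for x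
  have sign_u: "0 \<le> poly (rodrigues k (Suc j)) x \<Longrightarrow> 0 \<le> u x"
    "poly (rodrigues k (Suc j)) x \<le> 0 \<Longrightarrow> u x \<le> 0" if "x \<in> I" for x
    using Q_pos[OF that] f_nonneg[of x]
    by (auto simp: u_def LP mult_nonneg_nonneg mult_nonneg_nonpos simp del: rodrigues.simps)
  obtain a b where ab: "a \<in> I" "b \<in> I" "a \<le> \<mu>" "\<mu> \<le> b"
    "(\<forall>x\<in>I. b < x \<longrightarrow> 0 \<le> poly (rodrigues k (Suc j)) x) \<or> (\<forall>x\<in>I. b < x \<longrightarrow> poly (rodrigues k (Suc j)) x \<le> 0)"
    "(\<forall>x\<in>I. x < a \<longrightarrow> 0 \<le> poly (rodrigues k (Suc j)) x) \<or> (\<forall>x\<in>I. x < a \<longrightarrow> poly (rodrigues k (Suc j)) x \<le> 0)"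
    by (rule poly_eventually_const_sign[OF mean_in_I])
  have right: "(\<forall>x\<in>I. b < x \<longrightarrow> 0 \<le> u x) \<or> (\<forall>x\<in>I. b < x \<longrightarrow> u x \<le> 0)"
    using ab(5) sign_u by blast
  have left: "(\<forall>x\<in>I. x < a \<longrightarrow> 0 \<le> u x) \<or> (\<forall>x\<in>I. x < a \<longrightarrow> u x \<le> 0)"
    using ab(6) sign_u by blast
  have u: "integrable lborel u" "(\<integral>t. u t \<partial>lborel) = 0" "\<And>t. t \<notin> I \<Longrightarrow> u t = 0"
    unfolding u_def using P degree_L[of P] integral_L(2)[OF P] f_eq_0
    by (auto intro!: poly_integrable)
  have U: "poly P x * G x = (LINT t:{..x}|lborel. u t)" for x
    using integral_L(1)[OF P] by (simp add: u_def)
  have hU: "h' x * (poly P x * G x) = f x * (poly (Q ^ (k - j) * rodrigues k j) x * h' x)" for x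
    by (simp add: P_def G_def i mult_ac)
  note parts = integral_by_parts_const_sign[where U = "\<lambda>x. poly P x * G x" and u = u and h = h,
      OF ab(1-4) u U right left h'_meas h'_loc ftc, unfolded hU, OF _ _ _ _ _ _ _ int]
  have eq: "u x * h x = f x * (poly (Q ^ (k - Suc j) * rodrigues k (Suc j)) x * h x)" for x
    by (simp add: u_def LP i_def mult_ac del: rodrigues.simps)
  show "integrable lborel (\<lambda>x. f x * (poly (Q ^ (k - Suc j) * rodrigues k (Suc j)) x * h x))"
    using parts(1) unfolding eq by blast
  show "(\<integral>x. f x * (poly (Q ^ (k - Suc j) * rodrigues k (Suc j)) x * h x) \<partial>lborel)
       = - (\<integral>x. f x * (poly (Q ^ (k - j) * rodrigues k j) x * h' x) \<partial>lborel)"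
    using parts(2) unfolding eq by blast
qed

text \<open>The step is iterated from order \<open>k\<close> down to 0, and the \<open>k\<close>
  sign changes are absorbed by the factor \<open>(-1) ^ k\<close> in \<open>\<phi> k\<close>.
  Consecutive members of \<open>H\<close> are linked only through integrals, which covers
  polynomials as well as a top derivative that exists almost everywhere.\<close>

lemma stein_identity:
  fixes H :: "nat \<Rightarrow> real \<Rightarrow> real"
  assumes kn: "k \<le> n"
    and meas: "\<And>i. i < k \<Longrightarrow> H (Suc i) \<in> borel_measurable borel"
    and loc: "\<And>i c d. i < k \<Longrightarrow> c \<in> I \<Longrightarrow> d \<in> I \<Longrightarrow> c \<le> d \<Longrightarrow> set_integrable lborel {c..d} (H (Suc i))"
    and ftc: "\<And>i c d. i < k \<Longrightarrow> c \<in> I \<Longrightarrow> d \<in> I \<Longrightarrow> c \<le> d \<Longrightarrow>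
      (LINT x:{c..d}|lborel. H (Suc i) x) = H i d - H i c"
    and int: "integrable lborel (\<lambda>x. f x * (poly Q x ^ k * H k x))"
  shows "integrable lborel (\<lambda>x. f x * (poly (\<phi> k) x * H 0 x))"
    and "(\<integral>x. f x * (poly (\<phi> k) x * H 0 x) \<partial>lborel) = (\<integral>x. f x * (poly Q x ^ k * H k x) \<partial>lborel)"
proof -
  define J where "J j x = f x * (poly (Q ^ (k - j) * rodrigues k j) x * H (k - j) x)" for j x
  have "integrable lborel (J j) \<and>
      (\<integral>x. J j x \<partial>lborel) = (-1) ^ j * (\<integral>x. f x * (poly Q x ^ k * H k x) \<partial>lborel)" if "j \<le> k" for j
    using that
  proof (induction j)
    case 0
    then show ?case using int by (simp add: J_def)
  next
    case (Suc j)
    have jk: "j < k" and S: "k - j = Suc (k - Suc j)" and l: "k - Suc j < k" using Suc.prems by auto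
    have "integrable lborel (\<lambda>x. f x * (poly (Q ^ (k - j) * rodrigues k j) x * H (Suc (k - Suc j)) x))"
      using Suc.IH jk unfolding J_def S by simp
    note step = integral_rodrigues_step[OF kn jk meas[OF l] loc[OF l] ftc[OF l] this]
    show ?case
      using step Suc.IH jk unfolding J_def S by (simp del: rodrigues.simps poly_mult)
  qed
  from this[of k] have *: "integrable lborel (J k)"
    "(\<integral>x. J k x \<partial>lborel) = (-1) ^ k * (\<integral>x. f x * (poly Q x ^ k * H k x) \<partial>lborel)" by auto
  have J: "f x * (poly (\<phi> k) x * H 0 x) = (-1) ^ k * J k x" for x
    by (simp add: J_def \<phi>_def mult_ac)
  show "integrable lborel (\<lambda>x. f x * (poly (\<phi> k) x * H 0 x))"
    unfolding J using *(1) by simp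
  show "(\<integral>x. f x * (poly (\<phi> k) x * H 0 x) \<partial>lborel) = (\<integral>x. f x * (poly Q x ^ k * H k x) \<partial>lborel)"
    unfolding J using *(2) by (simp flip: power_mult_distrib mult.assoc)
qed

section \<open>Norms and orthogonality of the polynomials \<open>\<phi> k\<close>\<close>

lemma integral_Q_power_pos:
  assumes "k \<le> n"
  shows "0 < (\<integral>x. f x * poly Q x ^ k \<partial>lborel)"
proof (rule integral_pos_open[of _ I])
  show "integrable lborel (\<lambda>x. f x * poly Q x ^ k)"
    using poly_integrable[of "Q ^ k"] degree_Q_power[of k] assms by simp
  show pos: "0 < f x * poly Q x ^ k" if "x \<in> I" for x using f_pos Q_pos that by simp
  show "0 \<le> f x * poly Q x ^ k" for x
    using pos[of x] f_eq_0[of x] by (cases "x \<in> I") auto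
qed (use I_nonempty in auto)

lemma integral_phi_poly:
  assumes kn: "k \<le> n" and P: "degree P \<le> k"
  shows "(\<integral>x. f x * (poly (\<phi> k) x * poly P x) \<partial>lborel)
      = fact k * coeff P k * (\<integral>x. f x * poly Q x ^ k \<partial>lborel)"
proof -
  have "degree ((pderiv ^^ k) P) = 0" using P by (simp add: degree_higher_pderiv)
  then obtain c where c: "(pderiv ^^ k) P = [:c:]" by (rule degree_eq_zeroE)
  have "c = coeff ((pderiv ^^ k) P) 0" by (simp add: c)
  also have "\<dots> = fact k * coeff P k"
    by (simp add: coeff_higher_pderiv pochhammer_fact pochhammer_of_nat)
  finally have top: "(pderiv ^^ k) P = [:fact k * coeff P k:]" by (simp add: c)
  have "(\<integral>x. f x * (poly (\<phi> k) x * poly ((pderiv ^^ 0) P) x) \<partial>lborel)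
     = (\<integral>x. f x * (poly Q x ^ k * poly ((pderiv ^^ k) P) x) \<partial>lborel)"
  proof (rule stein_identity(2)[where H = "\<lambda>i. poly ((pderiv ^^ i) P)", OF kn])
    fix i and c d :: real assume "c \<le> d"
    let ?p = "(pderiv ^^ i) P"
    have si: "set_integrable lborel {c..d} (poly (pderiv ?p))"
      by (intro borel_integrable_atLeastAtMost' continuous_on_poly continuous_on_id)
    then show "set_integrable lborel {c..d} (poly ((pderiv ^^ Suc i) P))" by simp
    have "(poly (pderiv ?p) has_integral poly ?p d - poly ?p c) {c..d}"
      using \<open>c \<le> d\<close>
      by (intro fundamental_theorem_of_calculus)
        (auto simp: has_real_derivative_iff_has_vector_derivative[symmetric]
          intro: poly_DERIV has_field_derivative_at_within)
    then show "(LINT x:{c..d}|lborel. poly ((pderiv ^^ Suc i) P) x) = poly ?p d - poly ?p c"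
      using set_borel_integral_eq_integral(2)[OF si] by (simp add: integral_unique)
  next
    have "integrable lborel (\<lambda>x. fact k * coeff P k * (f x * poly (Q ^ k) x))"
      using degree_Q_power[of k] kn by (intro integrable_mult_right poly_integrable) simp
    then show "integrable lborel (\<lambda>x. f x * (poly Q x ^ k * poly ((pderiv ^^ k) P) x))"
      by (simp add: top mult_ac)
  next
    show "poly ((pderiv ^^ Suc i) P) \<in> borel_measurable borel" for i
      by (intro borel_measurable_continuous_onI continuous_on_poly continuous_on_id)
  qed
  also have "\<dots> = (\<integral>x. fact k * coeff P k * (f x * poly Q x ^ k) \<partial>lborel)"
    by (simp add: top mult_ac)
  finally show ?thesis by simp
qed

lemma integral_phi_phi:
  assumes "j \<le> n" "k \<le> n"
  shows "(\<integral>x. f x * (poly (\<phi> j) x * poly (\<phi> k) x) \<partial>lborel)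
     = (if j = k then fact k * lc k * (\<integral>x. f x * poly Q x ^ k \<partial>lborel) else 0)"
proof -
  have less: "(\<integral>x. f x * (poly (\<phi> i) x * poly (\<phi> l) x) \<partial>lborel) = 0" if "l < i" "i \<le> n" for i l
    using integral_phi_poly[of i "\<phi> l"] that degree_phi[of l] by (simp add: coeff_eq_0)
  consider "j = k" | "j < k" | "k < j" by linarith
  then show ?thesis
  proof cases
    case 1
    then show ?thesis
      using integral_phi_poly[of k "\<phi> k"] degree_phi[of k] assms by (simp add: coeff_phi)
  next
    case 2
    then show ?thesis using less[of j k] assms by (simp add: mult.commute mult.left_commute)
  next
    case 3
    then show ?thesis using less[of k j] assms by simp
  qed
qed

text \<open>Testing against \<open>\<phi> k\<close> with \<open>k\<close> the degree of
  \<open>P\<close> isolates the leading coefficient of \<open>P\<close>, multiplied by a positive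
  constant.\<close>

lemma poly_eq_0_if_orthogonal:
  assumes "degree P \<le> n"
    and "\<And>k. k \<le> n \<Longrightarrow> (\<integral>x. f x * (poly (\<phi> k) x * poly P x) \<partial>lborel) = 0"
  shows "P = 0"
  using integral_phi_poly[of "degree P" P] integral_Q_power_pos[of "degree P"] assms by auto

lemma Icc_subset_I: "c \<in> I \<Longrightarrow> d \<in> I \<Longrightarrow> {c..d} \<subseteq> I"
  by (auto simp: einterval_iff) (meson ereal_less_eq(3) le_less_trans less_le_trans)+

text \<open>The weight \<open>f q^k\<close> is continuous and positive on a compact subinterval,
  hence bounded below there by some \<open>m > 0\<close>. This turns the moment hypotheses into
  local integrability of the derivatives.\<close>

lemma set_integrable_of_weighted:
  assumes h: "h \<in> borel_measurable borel" and int: "integrable lborel (\<lambda>x. f x * (poly Q x ^ k * h x))"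
    and cd: "c \<in> I" "d \<in> I"
  shows "set_integrable lborel {c..d} h"
proof (cases "c \<le> d")
  case True
  note sub = Icc_subset_I[OF cd]
  have cont: "continuous_on {c..d} (\<lambda>x. f x * poly Q x ^ k)"
    by (intro continuous_intros continuous_on_subset[OF continuous_f sub])
  have "{c..d} \<noteq> {}" using True by simp
  then obtain z where z: "z \<in> {c..d}" "\<And>x. x \<in> {c..d} \<Longrightarrow> f z * poly Q z ^ k \<le> f x * poly Q x ^ k"
    using continuous_attains_inf[OF compact_Icc _ cont] by blast
  define m where "m = f z * poly Q z ^ k"
  have m: "0 < m" using f_pos Q_pos sub z(1) by (auto simp: m_def)
  show ?thesis
    unfolding set_integrable_def
  proof (rule Bochner_Integration.integrable_bound)
    show "integrable lborel (\<lambda>x. (1 / m) * (f x * (poly Q x ^ k * h x)))"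
      using int by (rule integrable_mult_right)
    show "(\<lambda>x. indicator {c..d} x *\<^sub>R h x) \<in> borel_measurable lborel" using h by simp
    have "\<bar>indicator {c..d} x *\<^sub>R h x\<bar> \<le> \<bar>(1 / m) * (f x * (poly Q x ^ k * h x))\<bar>" for x
    proof (cases "x \<in> {c..d}")
      case x: True
      then have "m \<le> f x * poly Q x ^ k" using z(2) by (simp add: m_def)
      then have "m * \<bar>h x\<bar> \<le> f x * poly Q x ^ k * \<bar>h x\<bar>" by (rule mult_right_mono) simp
      then have "m * \<bar>h x\<bar> \<le> \<bar>f x * (poly Q x ^ k * h x)\<bar>"
        using f_nonneg[of x] Q_pos[of x] x sub by (auto simp: abs_mult subset_eq mult.assoc)
      then show ?thesis using x m by (simp add: abs_mult field_simps)
    qed simp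
    then show "AE x in lborel. norm (indicator {c..d} x *\<^sub>R h x) \<le> norm ((1 / m) * (f x * (poly Q x ^ k * h x)))"
      by simp
  qed
qed (simp add: set_integrable_def)

end

subsection \<open>The variance bound\<close>

theorem theorem4p2:
  fixes M :: "'a measure" and X :: "'a \<Rightarrow> real" and f q :: "real \<Rightarrow> real"
    and \<mu> \<delta> \<beta> \<gamma> :: real and r s :: ereal and n :: nat
  assumes "prob_space M"
    and "distributed M lborel X (\<lambda>x. ennreal (f x))"
    and "\<And>x. 0 \<le> f x"
    and "integrable M X"
    and "\<mu> = prob_space.expectation M X"
    and "\<And>x. q x = \<delta> * x\<^sup>2 + \<beta> * x + \<gamma>"
    and "\<And>x. (LINT t:{..x}|lborel. (\<mu> - t) * f t) = q x * f x"
    and "{x. 0 < f x} = einterval r s"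
    and "1 \<le> n"
    and "integrable M (\<lambda>\<omega>. \<bar>X \<omega>\<bar> ^ (2 * n))"
  shows "\<delta> < 1 / (2 * real n - 1)
    \<and> (\<forall>j\<in>{1..2 * n - 2}. \<delta> \<noteq> 1 / real j)
    \<and> (\<forall>(g :: real \<Rightarrow> real) (D :: nat \<Rightarrow> real \<Rightarrow> real).
        derivatives_up_to n (einterval r s) g D \<longrightarrow>
        (\<forall>k\<le>n. integrable M (\<lambda>\<omega>. q (X \<omega>) ^ k * D k (X \<omega>))) \<longrightarrow>
        (let B = (\<Sum>k=1..n.
                    (prob_space.expectation M (\<lambda>\<omega>. q (X \<omega>) ^ k * D k (X \<omega>)))\<^sup>2
                    / (fact k * prob_space.expectation M (\<lambda>\<omega>. q (X \<omega>) ^ k)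
                       * (\<Prod>j=k-1..2*k-2. 1 - real j * \<delta>)))
         in ext_variance M (\<lambda>\<omega>. g (X \<omega>)) \<ge> ereal B
            \<and> (ext_variance M (\<lambda>\<omega>. g (X \<omega>)) = ereal B
               \<longleftrightarrow> (\<exists>p :: real poly. degree p \<le> n \<and> (\<forall>x\<in>einterval r s. g x = poly p x)))))"
proof -
  interpret prob_space M by fact
  note dist = assms(2) and f_nn = assms(3) and n_pos = assms(9)
  have f_meas: "f \<in> borel_measurable borel"
    using distributed_real_measurable[OF _ dist] f_nn by simp
  have X_meas [measurable]: "X \<in> borel_measurable M"
    using distributed_measurable[OF dist] by simp
  have E: "expectation (\<lambda>\<omega>. h (X \<omega>)) = (\<integral>x. f x * h x \<partial>lborel)"
    and int_iff: "integrable M (\<lambda>\<omega>. h (X \<omega>)) \<longleftrightarrow> integrable lborel (\<lambda>x. f x * h x)"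
    if "h \<in> borel_measurable borel" for h :: "real \<Rightarrow> real"
    using distributed_integral[OF dist, of h] distributed_integrable[OF dist, of h] that f_nn by auto
  interpret pearson f \<mu> \<delta> \<beta> \<gamma> r s n
  proof
    show "(\<integral>x. f x \<partial>lborel) = 1" using E[of "\<lambda>_. 1"] by (simp add: prob_space)
    show "integrable lborel (\<lambda>x. f x * \<bar>x\<bar> ^ (2 * n))"
      using int_iff[of "\<lambda>x. \<bar>x\<bar> ^ (2 * n)"] assms(10) by simp
    show "(\<integral>x. f x * x \<partial>lborel) = \<mu>" using E[of "\<lambda>x. x"] assms(5) by simp
  qed (use f_meas f_nn n_pos assms(6-8) in auto)
  have q: "q x = poly Q x" for x by (simp add: assms(6) poly_Q)
  have poly_meas [measurable]: "poly P \<in> borel_measurable borel" for P :: "real poly"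
    by (intro borel_measurable_continuous_onI continuous_on_poly continuous_on_id)
  have n1: "0 < 2 * real n - 1" using n_pos by linarith
  have "\<delta> < 1 / (2 * real n - 1)"
    using delta_less n1 by (simp add: field_simps)
  moreover have "\<delta> \<noteq> 1 / real j" if "j \<in> {1..2 * n - 2}" for j
    using index_delta_less[of j] that by auto
  moreover have "ext_variance M (\<lambda>\<omega>. g (X \<omega>)) \<ge> ereal B
      \<and> (ext_variance M (\<lambda>\<omega>. g (X \<omega>)) = ereal B
         \<longleftrightarrow> (\<exists>p :: real poly. degree p \<le> n \<and> (\<forall>x\<in>I. g x = poly p x)))"
    if deriv: "derivatives_up_to n I g D"
      and int: "\<forall>k\<le>n. integrable M (\<lambda>\<omega>. q (X \<omega>) ^ k * D k (X \<omega>))"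
      and B: "B = (\<Sum>k=1..n. (expectation (\<lambda>\<omega>. q (X \<omega>) ^ k * D k (X \<omega>)))\<^sup>2
                    / (fact k * expectation (\<lambda>\<omega>. q (X \<omega>) ^ k)
                       * (\<Prod>j=k-1..2*k-2. 1 - real j * \<delta>)))" for g D B
  proof -
    have D0: "D 0 = g" using deriv unfolding derivatives_up_to_def by auto
    have D_cont: "continuous_on I (D k)" if "k < n" for k
      using deriv that unfolding derivatives_up_to_def by auto
    have D_deriv: "(D k has_real_derivative D (Suc k) x) (at x)" if "k < n - 1" "x \<in> I" for k x
      using deriv that unfolding derivatives_up_to_def by auto
    have D_ac: "locally_abs_continuous_on I (D (n - 1))"
      and D_AE: "AE x in lborel. x \<in> I \<longrightarrow> (D (n - 1) has_real_derivative D n x) (at x)"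
      using deriv unfolding derivatives_up_to_def by auto
    \<comment> \<open>The law of \<open>X\<close> has density \<open>f\<close>, which vanishes off
      \<open>I\<close>, so null sets of \<open>I\<close> are invisible to \<open>X\<close>;
      \<open>X_AE\<close> goes back because \<open>f\<close> is positive on
      \<open>I\<close>.\<close>
    have AE_X: "AE \<omega> in M. P (X \<omega>)" if "AE x in lborel. x \<in> I \<longrightarrow> P x" for P
    proof (rule AE_distrD[of X M lborel])
      have "AE x in density lborel f. P x"
        using that f_meas f_eq_0 by (subst AE_density) (auto elim!: eventually_mono)
      then show "AE x in distr M lborel X. P x"
        unfolding distributed_distr_eq_density[OF dist] .
    qed simp
    have X_AE: "AE x in lborel. x \<in> I \<longrightarrow> P x" if "AE \<omega> in M. P (X \<omega>)" "{x. P x} \<in> sets borel" for P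
    proof -
      have "AE x in distr M lborel X. P x" using that by (subst AE_distr_iff) auto
      then have "AE x in density lborel f. P x" unfolding distributed_distr_eq_density[OF dist] .
      then show ?thesis
        using f_meas f_pos by (subst (asm) AE_density) (auto elim!: eventually_mono)
    qed
    obtain Hn where Hn: "Hn \<in> borel_measurable borel" "AE x in lborel. x \<in> I \<longrightarrow> Hn x = D n x"
      using borel_AE_derivative[OF open_einterval D_cont D_AE] n_pos by (metis One_nat_def Suc_le_eq diff_less zero_less_one)
    \<comment> \<open>A Borel family agreeing with \<open>D\<close> almost everywhere on
      \<open>I\<close>: lower orders are cut off outside \<open>I\<close>, where \<open>D\<close> is
      unconstrained, and the top order uses the Borel version \<open>Hn\<close>.\<close>
    define H where "H k x = (if k < n then indicator I x *\<^sub>R D k x else Hn x)" for k x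
    have H_meas [measurable]: "H k \<in> borel_measurable borel" for k
    proof (cases "k < n")
      case True
      then have "H k = (\<lambda>x. indicator I x *\<^sub>R D k x)" by (simp add: H_def fun_eq_iff)
      then show ?thesis using D_cont[OF True] by (simp only:) (rule borel_measurable_continuous_on_indicator, auto)
    next
      case False
      then have "H k = Hn" by (simp add: H_def fun_eq_iff)
      then show ?thesis using Hn(1) by simp
    qed
    have H_D: "H k x = D k x" if "x \<in> I" "k < n" for k x using that by (simp add: H_def)
    have H_AE: "AE \<omega> in M. q (X \<omega>) ^ k * D k (X \<omega>) = poly Q (X \<omega>) ^ k * H k (X \<omega>)" if "k \<le> n" for k
    proof (rule AE_X[of "\<lambda>x. q x ^ k * D k x = poly Q x ^ k * H k x"])
      show "AE x in lborel. x \<in> I \<longrightarrow> q x ^ k * D k x = poly Q x ^ k * H k x"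
        using Hn(2) by eventually_elim (use that in \<open>auto simp: H_def q le_less\<close>)
    qed
    have QH_meas: "(\<lambda>x. poly Q x ^ k * H k x) \<in> borel_measurable borel" for k
      by measurable
    have QH_X_meas: "(\<lambda>\<omega>. poly Q (X \<omega>) ^ k * H k (X \<omega>)) \<in> borel_measurable M" for k
      by (rule measurable_compose[OF X_meas QH_meas])
    have qD_int: "integrable M (\<lambda>\<omega>. q (X \<omega>) ^ k * D k (X \<omega>))" if "k \<le> n" for k
      using int that by blast
    have H_int: "integrable lborel (\<lambda>x. f x * (poly Q x ^ k * H k x))" if "k \<le> n" for k
      using integrable_cong_AE_imp[OF qD_int[OF that] QH_X_meas H_AE[OF that]] int_iff[OF QH_meas]
      by blast
    define e where "e k = expectation (\<lambda>\<omega>. q (X \<omega>) ^ k * D k (X \<omega>))" for k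
    have e: "e k = (\<integral>x. f x * (poly Q x ^ k * H k x) \<partial>lborel)" if "k \<le> n" for k
    proof -
      have "e k = expectation (\<lambda>\<omega>. poly Q (X \<omega>) ^ k * H k (X \<omega>))"
        unfolding e_def
        by (rule integral_cong_AE[OF borel_measurable_integrable[OF qD_int[OF that]] QH_X_meas H_AE[OF that]])
      then show ?thesis using E[OF QH_meas] by simp
    qed
    have H_loc: "set_integrable lborel {c..d} (H (Suc i))"
      and H_ftc: "(LINT x:{c..d}|lborel. H (Suc i) x) = H i d - H i c"
      if i: "i < n" and cd: "c \<in> I" "d \<in> I" "c \<le> d" for i c d
    proof -
      show si: "set_integrable lborel {c..d} (H (Suc i))"
        using i by (intro set_integrable_of_weighted[OF H_meas H_int cd(1,2)]) simp
      note sub = Icc_subset_I[OF cd(1,2)]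
      \<comment> \<open>Below the top order the derivative is classical; at \<open>Suc i = n\<close>
        local absolute continuity takes over.\<close>
      have "(H (Suc i) has_integral D i d - D i c) {c..d}"
      proof (cases "Suc i < n")
        case True
        have "(D (Suc i) has_integral D i d - D i c) {c..d}"
        proof (rule fundamental_theorem_of_calculus[OF cd(3)])
          fix x assume "x \<in> {c..d}"
          then have "(D i has_real_derivative D (Suc i) x) (at x)" using D_deriv True sub by auto
          then show "(D i has_vector_derivative D (Suc i) x) (at x within {c..d})"
            by (simp add: has_real_derivative_iff_has_vector_derivative has_vector_derivative_at_within)
        qed
        then show ?thesis
          by (rule has_integral_eq[rotated]) (use True sub H_D in \<open>auto simp: subset_eq\<close>)
      next
        case False
        then have n: "n = Suc i" using i by simp
        then have "H (Suc i) = Hn" by (simp add: H_def fun_eq_iff)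
        show ?thesis
        proof (rule fundamental_theorem_of_calculus_abs_continuous[OF _ cd(3)])
          show "abs_continuous_on_interval (D i) c d"
            using locally_abs_continuous_onD[OF D_ac cd(3) sub] n by simp
          show "AE x in lborel. x \<in> {c..d} \<longrightarrow> (D i has_real_derivative H (Suc i) x) (at x)"
            using D_AE Hn(2) by eventually_elim (use sub n \<open>H (Suc i) = Hn\<close> in auto)
        qed
      qed
      then show "(LINT x:{c..d}|lborel. H (Suc i) x) = H i d - H i c"
        using set_borel_integral_eq_integral(2)[OF si] cd H_D i by (simp add: integral_unique)
    qed
    have stein: "integrable lborel (\<lambda>x. f x * (poly (\<phi> k) x * H 0 x))"
      "(\<integral>x. f x * (poly (\<phi> k) x * H 0 x) \<partial>lborel) = e k" if k: "k \<le> n" for k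
      using stein_identity[of k H] k H_loc H_ftc H_int[OF k] e[OF k] by auto
    define Y where "Y = (\<lambda>\<omega>. g (X \<omega>))"
    have int_Y: "integrable M Y" using qD_int[of 0] by (simp add: Y_def D0)
    then have Y_meas [measurable]: "Y \<in> borel_measurable M" by simp
    have Y_H: "AE \<omega> in M. Y \<omega> = H 0 (X \<omega>)"
      unfolding Y_def using H_D[of _ 0] n_pos D0 by (intro AE_X) auto
    have E_\<phi>Y: "expectation (\<lambda>\<omega>. poly (\<phi> k) (X \<omega>) * Y \<omega>) = e k" if "k \<le> n" for k
    proof -
      have "expectation (\<lambda>\<omega>. poly (\<phi> k) (X \<omega>) * Y \<omega>) = expectation (\<lambda>\<omega>. poly (\<phi> k) (X \<omega>) * H 0 (X \<omega>))"
        using Y_H by (intro integral_cong_AE) (auto elim!: eventually_mono)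
      then show ?thesis using stein(2)[OF that] E[of "\<lambda>x. poly (\<phi> k) x * H 0 x"] by simp
    qed
    define d where "d k = fact k * lc k * (\<integral>x. f x * poly Q x ^ k \<partial>lborel)" for k
    have d_pos: "0 < d k" if "k \<le> n" for k
      using lc_pos integral_Q_power_pos that by (simp add: d_def)
    have B_eq: "B = (\<Sum>k=1..n. (e k)\<^sup>2 / d k)"
      unfolding B e_def d_def q lc_def using E[of "\<lambda>x. poly Q x ^ _"] by (simp add: mult_ac)
    \<comment> \<open>Thus orthogonality to \<open>\<phi> 0\<close> says that the other
      \<open>\<phi> k\<close> have mean 0.\<close>
    have phi_0: "\<phi> 0 = 1" by (simp add: \<phi>_def)
    have int_poly_sq: "integrable M (\<lambda>\<omega>. (poly P (X \<omega>))\<^sup>2)" if "degree P \<le> n" for P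
    proof -
      have "integrable lborel (\<lambda>x. f x * poly (P\<^sup>2) x)"
        using that by (intro poly_integrable order_trans[OF degree_power_le]) simp
      then show ?thesis using int_iff[of "\<lambda>x. (poly P x)\<^sup>2"] by simp
    qed
    have E_\<phi>\<phi>: "expectation (\<lambda>\<omega>. poly (\<phi> j) (X \<omega>) * poly (\<phi> k) (X \<omega>)) = (if j = k then d k else 0)"
      if "j \<le> n" "k \<le> n" for j k
      using integral_phi_phi[OF that] E[of "\<lambda>x. poly (\<phi> j) x * poly (\<phi> k) x"] by (simp add: d_def)
    have E_\<phi>: "expectation (\<lambda>\<omega>. poly (\<phi> k) (X \<omega>)) = 0" if "k \<in> {1..n}" for k
      using E_\<phi>\<phi>[of k 0] that by (simp add: phi_0)
    \<comment> \<open>When \<open>Y\<close> is square integrable, \<open>R (X)\<close> is its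
      orthogonal projection onto the span of the \<open>\<phi> k (X)\<close> with
      \<open>k \<le> n\<close>, and \<open>Y - R (X)\<close> is the residual.\<close>
    define R where "R = [:expectation Y:] + (\<Sum>k=1..n. smult (e k / d k) (\<phi> k))"
    have degree_R: "degree R \<le> n"
      unfolding R_def
      by (intro degree_add_le degree_sum_le) (auto intro: order_trans[OF degree_smult_le] order_trans[OF degree_phi])
    show ?thesis
    proof (cases "integrable M (\<lambda>\<omega>. (Y \<omega>)\<^sup>2)")
      case True
      define W where "W \<omega> = Y \<omega> - poly R (X \<omega>)" for \<omega>
      have W: "W \<omega> = Y \<omega> - expectation Y - (\<Sum>k=1..n.
          expectation (\<lambda>\<omega>. poly (\<phi> k) (X \<omega>) * Y \<omega>) / d k * poly (\<phi> k) (X \<omega>))" for \<omega>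
        using E_\<phi>Y by (simp add: W_def R_def poly_sum)
      note expansion = variance_orthogonal_expansion[OF int_Y True,
          where n = n and \<phi> = "\<lambda>k \<omega>. poly (\<phi> k) (X \<omega>)" and d = d, folded W]
      have hyps: "\<And>k. k \<in> {1..n} \<Longrightarrow> (\<lambda>\<omega>. poly (\<phi> k) (X \<omega>)) \<in> borel_measurable M"
        "\<And>k. k \<in> {1..n} \<Longrightarrow> integrable M (\<lambda>\<omega>. (poly (\<phi> k) (X \<omega>))\<^sup>2)"
        "\<And>j k. j \<in> {1..n} \<Longrightarrow> k \<in> {1..n} \<Longrightarrow>
          expectation (\<lambda>\<omega>. poly (\<phi> j) (X \<omega>) * poly (\<phi> k) (X \<omega>)) = (if j = k then d k else 0)"
        "\<And>k. k \<in> {1..n} \<Longrightarrow> 0 < d k"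
        using E_\<phi>\<phi> d_pos by (auto intro!: int_poly_sq order_trans[OF degree_phi])
      note expansion = expansion[OF hyps(1,2) E_\<phi> hyps(3,4)]
      have var: "variance Y = B + expectation (\<lambda>\<omega>. (W \<omega>)\<^sup>2)"
        using expansion(2) E_\<phi>Y by (simp add: B_eq)
      have nonneg: "0 \<le> expectation (\<lambda>\<omega>. (W \<omega>)\<^sup>2)" by simp
      have ext: "ext_variance M (\<lambda>\<omega>. g (X \<omega>)) = ereal (variance Y)"
        using True by (simp add: ext_variance_def Y_def)
      have W_0_iff: "expectation (\<lambda>\<omega>. (W \<omega>)\<^sup>2) = 0 \<longleftrightarrow> (AE \<omega> in M. W \<omega> = 0)"
        using expansion(1) by (subst integral_nonneg_eq_0_iff_AE) auto
      have W_H: "AE \<omega> in M. W \<omega> = H 0 (X \<omega>) - poly R (X \<omega>)"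
        using Y_H by (auto simp: W_def elim!: eventually_mono)
      have "(\<exists>p. degree p \<le> n \<and> (\<forall>x\<in>I. g x = poly p x))" if "AE \<omega> in M. W \<omega> = 0"
      proof (intro exI[of _ R] conjI degree_R)
        have "AE \<omega> in M. H 0 (X \<omega>) - poly R (X \<omega>) = 0"
          using that W_H by eventually_elim simp
        then have "AE x in lborel. x \<in> I \<longrightarrow> H 0 x - poly R x = 0"
          by (rule X_AE) measurable
        then have AE: "AE x in lborel. x \<notin> {x\<in>I. g x - poly R x \<noteq> 0}"
          by eventually_elim (use H_D[of _ 0] n_pos D0 in auto)
        \<comment> \<open>Continuity upgrades almost everywhere to everywhere: the set where
          \<open>g\<close> and \<open>R\<close> differ is open and null, hence empty.\<close>
        have "continuous_on I (\<lambda>x. g x - poly R x)"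
          using D_cont[of 0] n_pos D0 by (intro continuous_intros) auto
        then have "open (I \<inter> (\<lambda>x. g x - poly R x) -` (- {0}))"
          by (rule continuous_open_preimage) auto
        moreover have "I \<inter> (\<lambda>x. g x - poly R x) -` (- {0}) = {x\<in>I. g x - poly R x \<noteq> 0}" by auto
        ultimately have op: "open {x\<in>I. g x - poly R x \<noteq> 0}" by simp
        have "{x\<in>I. g x - poly R x \<noteq> 0} \<in> null_sets lborel"
          using AE op by (subst AE_iff_null_sets) auto
        then have "negligible {x\<in>I. g x - poly R x \<noteq> 0}"
          using null_sets_completionI negligible_iff_null_sets by blast
        then have "{x\<in>I. g x - poly R x \<noteq> 0} = {}" using op open_not_negligible by blast
        then show "\<forall>x\<in>I. g x = poly R x" by auto
      qed
      moreover have "AE \<omega> in M. W \<omega> = 0" if p: "degree p \<le> n" "\<And>x. x \<in> I \<Longrightarrow> g x = poly p x" for p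
      proof -
        have Wp: "AE \<omega> in M. W \<omega> = poly (p - R) (X \<omega>)"
          unfolding W_def Y_def using p(2)
          by (intro AE_X[of "\<lambda>x. g x - poly R x = poly (p - R) x"]) auto
        \<comment> \<open>Almost surely the residual is \<open>(p - R) (X)\<close>, with
          \<open>p - R\<close> of degree at most \<open>n\<close> and orthogonal to every
          \<open>\<phi> k\<close>, \<open>k \<le> n\<close>.\<close>
        have "p - R = 0"
        proof (rule poly_eq_0_if_orthogonal)
          show "degree (p - R) \<le> n" using p(1) degree_R by (rule degree_diff_le)
          fix k assume k: "k \<le> n"
          have "(\<integral>x. f x * (poly (\<phi> k) x * poly (p - R) x) \<partial>lborel)
              = expectation (\<lambda>\<omega>. poly (\<phi> k) (X \<omega>) * poly (p - R) (X \<omega>))"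
            by (rule E[symmetric]) measurable
          also have "\<dots> = expectation (\<lambda>\<omega>. poly (\<phi> k) (X \<omega>) * W \<omega>)"
            using Wp by (intro integral_cong_AE) (auto simp: W_def elim!: eventually_mono)
          also have "\<dots> = 0"
            using expansion(3)[of k] expansion(4) k by (cases "k = 0") (auto simp: phi_0)
          finally show "(\<integral>x. f x * (poly (\<phi> k) x * poly (p - R) x) \<partial>lborel) = 0" .
        qed
        then show ?thesis using Wp by simp
      qed
      ultimately show ?thesis
        unfolding ext using var nonneg W_0_iff by auto
    next
      \<comment> \<open>The variance is infinite and the bound trivial. Equality fails, as it
        should: a polynomial of degree at most \<open>n\<close> in \<open>X\<close> has a finite
        second moment.\<close>
      case False
      have "\<not> (degree p \<le> n \<and> (\<forall>x\<in>I. g x = poly p x))" for p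
      proof
        assume p: "degree p \<le> n \<and> (\<forall>x\<in>I. g x = poly p x)"
        have meas: "(\<lambda>\<omega>. (Y \<omega>)\<^sup>2) \<in> borel_measurable M" by measurable
        have AE: "AE \<omega> in M. (poly p (X \<omega>))\<^sup>2 = (Y \<omega>)\<^sup>2"
          unfolding Y_def using p by (intro AE_X[of "\<lambda>x. (poly p x)\<^sup>2 = (g x)\<^sup>2"]) auto
        have "integrable M (\<lambda>\<omega>. (Y \<omega>)\<^sup>2)"
          by (rule integrable_cong_AE_imp[OF int_poly_sq meas AE]) (use p in blast)
        then show False using False by blast
      qed
      then show ?thesis
        using False by (auto simp: ext_variance_def Y_def)
    qed
  qed
  ultimately show ?thesis unfolding Let_def by blast
qed

end
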